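(* Let $C\subseteq\mathbb R^d$ be a $p$-convex set ($p\in\mathbb N$) with $|C|=1$, let $\mathbf c_n=(c_{n,1},\dots,c_{n,d})$ be vectors with $0<c_{n,\ell}\to\infty$ for each $\ell$, and let $D_n=(\mathbf c_nC)\cap\mathbb Z^d$. Let $(\xi_v)_{v\in\mathbb Z^d}$ be a stationary real-valued random field satisfying condition $\mathcal D(x_n;K_n)$ for some real sequence $(x_n)_{n\in\mathbb N}$, with associated vectors $\boldsymbol\gamma_n$ and constants $\alpha_n$. Let $(k_n)$ be a sequence of integers satisfying $k_n\to\infty$, $k_n\alpha_n\to0$ and $k_n^{1/d}\boldsymbol\gamma_n=o(\mathbf c_n)$ as $n\to\infty$, such that condition $\mathcal D^\ell(x_n;k_n;1)$ is satisfied. If, for some $0<\tau<\infty$, $|D_n|\,\mathbb P(\xi_0>x_n)\to\tau$, then $\overline N_n\stackrel{vd}{\to}\overline N$, where $\overline N$ is a homogeneous Poisson process on $C$ with intensity $\tau$.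
   Context: Notation: $d\in\mathbb N$; $|\cdot|$ denotes the Euclidean norm of a point, Lebesgue measure of a full-dimensional subset of $\mathbb R^d$, and cardinality of a subset of $\mathbb Z^d$. For vectors $\mathbf r=(r_1,\dots,r_d)$ and $A\subseteq\mathbb R^d$, $\mathbf rA=\{(r_1a_1,\dots,r_da_d):a\in A\}$; products and quotients of vectors are coordinate-wise. $A\oplus B$ is the Minkowski sum, $B(1)$ the closed Euclidean unit ball. $\mathbf r_n=o(\mathbf c_n)$ means $r_{n,\ell}/c_{n,\ell}\to0$ for each $\ell$. $M_\xi(A)=\max_{v\in A}\xi_v$, with $M_\xi(\emptyset)=-\infty$. A convex body is a compact convex subset of $\mathbb R^d$ with non-empty interior; a set is $p$-convex if it is a union of $p$ convex bodies. Write $C_n=\mathbf c_nC$. Boxes: every sequence $(k_n)$ considered consists of positive integers with $k_n\to\infty$ and $k_n^{1/d}=o(c_{n,\ell})$ for all $\ell$. Put $t_{n,k_n}^\ell=\lfloor c_{n,\ell}/k_n^{1/d}\rfloor$, $\mathbf t_{n,k_n}=(t_{n,k_n}^1,\dots,t_{n,k_n}^d)$, and for $z\in\mathbb Z^d$, $I_z^{n,k_n}=\mathbf t_{n,k_n}(z+[0,1)^d)$, $J_z^{n,k_n}=I_z^{n,k_n}\cap\mathbb Z^d$, and $D_{n,k_n}^+=\bigcup\{J_z^{n,k_n}: I_z^{n,k_n}\cap C_n\ne\emptyset\}$. $K_n=\mathbb Z^d\cap\mathbf c_n[-c,c]^d$, where $0<c<\infty$ is a fixed constant (which can be chosen independently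 of $(k_n)$) such that $D_{n,k_n}^+\subseteq K_n$ for all $n$. Condition $\mathcal D(x_n;K_n)$: sets $A,B\subseteq\mathbb Z^d$ are $\boldsymbol\gamma$-separated if $B\subseteq(A\oplus\boldsymbol\gamma B(1))^c$. The condition holds for $(\xi_v)$ if there is an increasing sequence of $d$-dimensional vectors $\boldsymbol\gamma_n$ with $\boldsymbol\gamma_n=o(\mathbf c_n)$ and constants $\alpha_n\to0$ such that for all $n$ and all $\boldsymbol\gamma_n$-separated $A,B\subseteq K_n$, at least one of which is a box, $|\mathbb P(M_\xi(A\cup B)\le x_n)-\mathbb P(M_\xi(A)\le x_n)\mathbb P(M_\xi(B)\le x_n)|\le\alpha_n$. Order: $\preceq$ is an arbitrary fixed translation invariant total order on $\mathbb Z^d$, and $A_v^{n,k_n}=\{z\in(v+\mathbf t_{n,k_n}[-1,1]^d)\cap\mathbb Z^d: v\prec z\}$. Condition $\mathcal D^\ell(x_n;k_n;1)$: $\mathbb P(M_\xi(A_0^{n,k_n})\le x_n\mid\xi_0>x_n)\to1$ as $n\to\infty$. Exceedance process: $\overline N_n(A)=\sum_{z\in\mathbb Z^d}\mathbf 1_A(z/\mathbf c_n)\mathbf 1_{\{\xi_z>x_n\}}$ for Borel $A\subseteq C$. Convergence: $\overline N_n\stackrel{vd}{\to}\overline N$ (convergence in distribution with respect to the vague topology) means that $\int_Cf\,d\overline N_n\to\int_Cf\,d\overline N$ in distribution for all bounded continuous functions $f:C\to[0,\infty)$ with compact support. *)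

theory Defs
  imports "HOL-Probability.Probability"
begin

text \<open>
  Points of \<open>\<int>\<^sup>d\<close> have type \<open>int ^ 'd\<close>, points of \<open>\<real>\<^sup>d\<close> have type \<open>real ^ 'd\<close>, and
  \<open>d = CARD('d)\<close>. The library's product and order on vectors are coordinate-wise.
\<close>

definition real_vec :: "int ^ 'd \<Rightarrow> real ^ 'd" where
  "real_vec z = (\<chi> l. real_of_int (z $ l))"

definition vec_quot :: "real ^ 'd \<Rightarrow> real ^ 'd \<Rightarrow> real ^ 'd" where
  "vec_quot a r = (\<chi> l. a $ l / r $ l)"

definition vec_scale :: "real ^ 'd \<Rightarrow> (real ^ 'd) set \<Rightarrow> (real ^ 'd) set" where
  "vec_scale r A = (\<lambda>a. r * a) ` A"

definition vec_small_o :: "(nat \<Rightarrow> real ^ 'd) \<Rightarrow> (nat \<Rightarrow> real ^ 'd) \<Rightarrow> bool" where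
  "vec_small_o r c \<longleftrightarrow> (\<forall>l. (\<lambda>n. r n $ l / c n $ l) \<longlonglongrightarrow> 0)"

definition convex_body :: "(real ^ 'd) set \<Rightarrow> bool" where
  "convex_body K \<longleftrightarrow> compact K \<and> convex K \<and> interior K \<noteq> {}"

definition p_convex :: "nat \<Rightarrow> (real ^ 'd) set \<Rightarrow> bool" where
  "p_convex p C \<longleftrightarrow> (\<exists>K :: nat \<Rightarrow> (real ^ 'd) set. (\<forall>i<p. convex_body (K i)) \<and> C = (\<Union>i<p. K i))"


subsection \<open>Lattice sets\<close>

text \<open>The arguments \<open>c\<close> and \<open>k\<close> stand for the \<open>n\<close>-th terms of the respective sequences.\<close>

definition lattice_points :: "(real ^ 'd) set \<Rightarrow> (int ^ 'd) set" where
  "lattice_points A = {z. real_vec z \<in> A}"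

definition block_side :: "real ^ 'd \<Rightarrow> nat \<Rightarrow> real ^ 'd" where
  "block_side c k = (\<chi> l. real_of_int \<lfloor>c $ l / root CARD('d) (real k)\<rfloor>)"

definition block_I :: "real ^ 'd \<Rightarrow> nat \<Rightarrow> int ^ 'd \<Rightarrow> (real ^ 'd) set" where
  "block_I c k z =
     vec_scale (block_side c k) ((\<lambda>u. real_vec z + u) ` {u. \<forall>l. 0 \<le> u $ l \<and> u $ l < 1})"

definition block_J :: "real ^ 'd \<Rightarrow> nat \<Rightarrow> int ^ 'd \<Rightarrow> (int ^ 'd) set" where
  "block_J c k z = lattice_points (block_I c k z)"

definition D_plus :: "(real ^ 'd) set \<Rightarrow> real ^ 'd \<Rightarrow> nat \<Rightarrow> (int ^ 'd) set" where
  "D_plus C c k = \<Union> {block_J c k z | z. block_I c k z \<inter> vec_scale c C \<noteq> {}}"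

definition K_set :: "real \<Rightarrow> real ^ 'd \<Rightarrow> (int ^ 'd) set" where
  "K_set \<kappa> c = lattice_points (vec_scale c {u. \<forall>l. - \<kappa> \<le> u $ l \<and> u $ l \<le> \<kappa>})"

definition is_box :: "(int ^ 'd) set \<Rightarrow> bool" where
  "is_box A \<longleftrightarrow> (\<exists>a b. A = {a..b})"

text \<open>Below, \<open>+\<close> on sets is the Minkowski sum from \<^theory>\<open>HOL-Library.Set_Algebras\<close>.\<close>

definition separated :: "real ^ 'd \<Rightarrow> (int ^ 'd) set \<Rightarrow> (int ^ 'd) set \<Rightarrow> bool" where
  "separated \<gamma> A B \<longleftrightarrow> real_vec ` B \<subseteq> - (real_vec ` A + vec_scale \<gamma> (cball 0 1))"

definition translation_invariant_order :: "((int ^ 'd) \<times> (int ^ 'd)) set \<Rightarrow> bool" where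
  "translation_invariant_order r \<longleftrightarrow>
     linear_order r \<and> (\<forall>u v w. (u, v) \<in> r \<longrightarrow> (u + w, v + w) \<in> r)"

definition A_set ::
  "((int ^ 'd) \<times> (int ^ 'd)) set \<Rightarrow> real ^ 'd \<Rightarrow> nat \<Rightarrow> int ^ 'd \<Rightarrow> (int ^ 'd) set" where
  "A_set r c k v =
     {z \<in> lattice_points ((\<lambda>u. real_vec v + u) `
             vec_scale (block_side c k) {u. \<forall>l. - 1 \<le> u $ l \<and> u $ l \<le> 1}).
        (v, z) \<in> r \<and> v \<noteq> z}"


subsection \<open>Random fields\<close>

definition stationary_field :: "'a measure \<Rightarrow> (int ^ 'd \<Rightarrow> 'a \<Rightarrow> real) \<Rightarrow> bool" where
  "stationary_field M \<xi> \<longleftrightarrow>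
     (\<forall>v. \<xi> v \<in> borel_measurable M) \<and>
     (\<forall>h. distr M (Pi\<^sub>M UNIV (\<lambda>_. borel)) (\<lambda>\<omega> v. \<xi> (v + h) \<omega>) =
          distr M (Pi\<^sub>M UNIV (\<lambda>_. borel)) (\<lambda>\<omega> v. \<xi> v \<omega>))"

text \<open>In \<^typ>\<open>ereal\<close> the supremum over the empty set is \<open>-\<infinity>\<close>; for finite nonempty \<open>A\<close> it is the maximum.\<close>

definition field_max :: "(int ^ 'd \<Rightarrow> 'a \<Rightarrow> real) \<Rightarrow> (int ^ 'd) set \<Rightarrow> 'a \<Rightarrow> ereal" where
  "field_max \<xi> A \<omega> = (SUP v\<in>A. ereal (\<xi> v \<omega>))"

definition condition_D ::
  "'a measure \<Rightarrow> (int ^ 'd \<Rightarrow> 'a \<Rightarrow> real) \<Rightarrow> (nat \<Rightarrow> real ^ 'd) \<Rightarrow> (nat \<Rightarrow> real) \<Rightarrow>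
   (nat \<Rightarrow> (int ^ 'd) set) \<Rightarrow> (nat \<Rightarrow> real ^ 'd) \<Rightarrow> (nat \<Rightarrow> real) \<Rightarrow> bool" where
  "condition_D M \<xi> c x K \<gamma> \<alpha> \<longleftrightarrow>
     mono \<gamma> \<and> vec_small_o \<gamma> c \<and> \<alpha> \<longlonglongrightarrow> 0 \<and>
     (\<forall>n A B. A \<subseteq> K n \<and> B \<subseteq> K n \<and> separated (\<gamma> n) A B \<and> (is_box A \<or> is_box B) \<longrightarrow>
        \<bar>\<P>(\<omega> in M. field_max \<xi> (A \<union> B) \<omega> \<le> ereal (x n))
          - \<P>(\<omega> in M. field_max \<xi> A \<omega> \<le> ereal (x n)) * \<P>(\<omega> in M. field_max \<xi> B \<omega> \<le> ereal (x n))\<bar>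
        \<le> \<alpha> n)"

definition condition_D_local ::
  "'a measure \<Rightarrow> (int ^ 'd \<Rightarrow> 'a \<Rightarrow> real) \<Rightarrow> ((int ^ 'd) \<times> (int ^ 'd)) set \<Rightarrow>
   (nat \<Rightarrow> real ^ 'd) \<Rightarrow> (nat \<Rightarrow> real) \<Rightarrow> (nat \<Rightarrow> nat) \<Rightarrow> bool" where
  "condition_D_local M \<xi> r c x k \<longleftrightarrow>
     (\<lambda>n. \<P>(\<omega> in M. field_max \<xi> (A_set r (c n) (k n) 0) \<omega> \<le> ereal (x n) \<bar> \<xi> 0 \<omega> > x n))
       \<longlonglongrightarrow> 1"


subsection \<open>Point processes\<close>

text \<open>The sum over \<open>\<int>\<^sup>d\<close> with values in \<open>[0, \<infinity>]\<close> is the integral with respect to counting measure.\<close>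

definition exceedance_process ::
  "(real ^ 'd) set \<Rightarrow> (int ^ 'd \<Rightarrow> 'a \<Rightarrow> real) \<Rightarrow> real ^ 'd \<Rightarrow> real \<Rightarrow> 'a \<Rightarrow> (real ^ 'd) measure" where
  "exceedance_process C \<xi> c x \<omega> =
     measure_of C (sets (restrict_space borel C))
       (\<lambda>A. \<integral>\<^sup>+z. indicator A (vec_quot (real_vec z) c) * indicator {z. \<xi> z \<omega> > x} z \<partial>count_space UNIV)"

text \<open>
  Realizations are locally finite counting measures on the Borel sets of \<open>C\<close>; in
  \<^typ>\<open>ennreal\<close>, membership in \<open>\<nat>\<close> excludes the value \<open>\<infinity>\<close>.
\<close>

definition point_process ::
  "'b measure \<Rightarrow> (real ^ 'd) set \<Rightarrow> ('b \<Rightarrow> (real ^ 'd) measure) \<Rightarrow> bool" where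
  "point_process M C N \<longleftrightarrow>
     (\<forall>\<omega>\<in>space M. sets (N \<omega>) = sets (restrict_space borel C)) \<and>
     (\<forall>\<omega>\<in>space M. \<forall>B\<in>sets (restrict_space borel C). bounded B \<longrightarrow> emeasure (N \<omega>) B \<in> \<nat>) \<and>
     (\<forall>B\<in>sets (restrict_space borel C). (\<lambda>\<omega>. emeasure (N \<omega>) B) \<in> borel_measurable M)"

definition homogeneous_poisson_process ::
  "'b measure \<Rightarrow> (real ^ 'd) set \<Rightarrow> real \<Rightarrow> ('b \<Rightarrow> (real ^ 'd) measure) \<Rightarrow> bool" where
  "homogeneous_poisson_process M C \<tau> N \<longleftrightarrow>
     prob_space M \<and> point_process M C N \<and>
     (\<forall>B\<in>sets (restrict_space borel C). bounded B \<longrightarrow>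
        (\<forall>j::nat. \<P>(\<omega> in M. emeasure (N \<omega>) B = of_nat j) =
           (\<tau> * measure lborel B) ^ j / fact j * exp (- (\<tau> * measure lborel B)))) \<and>
     (\<forall>(I :: nat set) B. finite I \<and> B ` I \<subseteq> sets (restrict_space borel C) \<and> disjoint_family_on B I \<longrightarrow>
        prob_space.indep_vars M (\<lambda>_. borel) (\<lambda>i \<omega>. emeasure (N \<omega>) (B i)) I)"

definition vd_converges ::
  "(real ^ 'd) set \<Rightarrow> 'a measure \<Rightarrow> (nat \<Rightarrow> 'a \<Rightarrow> (real ^ 'd) measure) \<Rightarrow>
   'b measure \<Rightarrow> ('b \<Rightarrow> (real ^ 'd) measure) \<Rightarrow> bool" where
  "vd_converges C M Nn M' N \<longleftrightarrow>
     (\<forall>f :: real ^ 'd \<Rightarrow> real.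
        continuous_on C f \<and> (\<forall>y\<in>C. 0 \<le> f y) \<and> bounded (f ` C) \<and>
        compact (C \<inter> closure {y \<in> C. f y \<noteq> 0}) \<longrightarrow>
        weak_conv_m (\<lambda>n. distr M borel (\<lambda>\<omega>. \<integral>y. f y \<partial>Nn n \<omega>))
                    (distr M' borel (\<lambda>\<omega>. \<integral>y. f y \<partial>N \<omega>)))"

text \<open>Sanity check: the defining set function of the exceedance process is indeed a measure.\<close>

lemma emeasure_exceedance_process:
  fixes C :: "(real ^ 'd) set"
  assumes A: "A \<in> sets (restrict_space borel C)"
  shows "emeasure (exceedance_process C \<xi> c x \<omega>) A =
           (\<integral>\<^sup>+z. indicator A (vec_quot (real_vec z) c) * indicator {z. \<xi> z \<omega> > x} z \<partial>count_space UNIV)"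
proof -
  let ?S = "sets (restrict_space borel C)"
  let ?g = "\<lambda>z. vec_quot (real_vec z) c"
  let ?\<mu> = "\<lambda>A. \<integral>\<^sup>+z. indicator A (?g z) * indicator {z. \<xi> z \<omega> > x} z \<partial>count_space UNIV"
  have sa: "sigma_algebra C ?S"
    using sets.sigma_algebra_axioms[of "restrict_space borel C"] by (simp add: space_restrict_space)
  have "countably_additive ?S ?\<mu>"
    unfolding countably_additive_def
  proof (intro allI impI)
    fix F :: "nat \<Rightarrow> (real ^ 'd) set" assume F: "disjoint_family F"
    have "(\<Sum>i. \<integral>\<^sup>+z. indicator (F i) (?g z) * indicator {z. \<xi> z \<omega> > x} z \<partial>count_space UNIV)
        = (\<integral>\<^sup>+z. (\<Sum>i. indicator (F i) (?g z) * indicator {z. \<xi> z \<omega> > x} z) \<partial>count_space UNIV)"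
      by (subst nn_integral_suminf) auto
    also have "\<dots> = (\<integral>\<^sup>+z. indicator (\<Union>i. F i) (?g z) * indicator {z. \<xi> z \<omega> > x} z \<partial>count_space UNIV)"
      by (simp add: suminf_indicator[OF F] ennreal_suminf_multc)
    finally show "(\<Sum>i. \<integral>\<^sup>+z. indicator (F i) (?g z) * indicator {z. \<xi> z \<omega> > x} z \<partial>count_space UNIV)
        = (\<integral>\<^sup>+z. indicator (\<Union>i. F i) (?g z) * indicator {z. \<xi> z \<omega> > x} z \<partial>count_space UNIV)" .
  qed
  moreover have "positive ?S ?\<mu>" by (simp add: positive_def)
  ultimately show ?thesis
    unfolding exceedance_process_def
    by (intro emeasure_measure_of_sigma[OF sa] A)
qed

end

theory Submission
  imports Defs "HOL-Real_Asymp.Real_Asymp"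
begin

text \<open>
  The blocks of side \<open>t = \<lfloor>c / k^(1/d)\<rfloor>\<close> contained in \<open>c U\<close> number about \<open>k \<bar>U\<bar>\<close> and cover \<open>c U\<close> up to a
  negligible part. Shortened by \<open>\<gamma>\<close> they are separated, so by condition \<open>\<D>\<close> the probability of no
  exceedance in \<open>c U\<close> is \<open>q\<close> to the power \<open>k \<bar>U\<bar>\<close> up to an error of order \<open>k \<alpha> \<longlonglongrightarrow> 0\<close>, where \<open>q\<close> is
  the probability of no exceedance in one block. A union bound, and the local condition applied to the
  last exceedance in the block, give \<open>k (1 - q) \<longlonglongrightarrow> \<tau>\<close>, so the void probability of \<open>U\<close> tends to
  \<open>exp (- \<tau> \<bar>U\<bar>)\<close>.

  Let \<open>C\<close> be divided into small cells. By inclusion-exclusion the void probabilities of unions of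
  cells determine the joint law of the indicators of the occupied cells, and since also the mean number
  of points converges to \<open>\<tau>\<close>, multiply occupied cells are asymptotically negligible as the cells
  shrink. Hence the characteristic functions of the integrals of continuous functions converge, and
  Levy's continuity theorem applies.
\<close>

section \<open>Grid cells and lattice point counts\<close>

text \<open>Both dependence conditions are statements about maxima: what they control are events of
  no exceedance rather than counts. This is why the limit is identified through void probabilities,
  with convergence of the mean ruling out multiple points. Since inclusion-exclusion ranges over all
  unions of cells, the void limit is proved for every Borel set \<open>U\<close> in \<open>C\<close>
  with Lebesgue-null frontier. Condition D asks that one of its two sets be a box, so blocks are
  split off one at a time; each of the roughly k |U| steps costs \<alpha>, which is the origin of k
  \<alpha> -> 0. The gap \<gamma> has to be negligible against the block side c / k^(1/d), which is
  the assumption k^(1/d) \<gamma> = o(c). A block has an expected number of exceedances of about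
  \<tau> / k and thus behaves like one Bernoulli trial. Convexity of the bodies that make up
  \<open>C\<close> enters through the nullity of their frontiers.\<close>

definition grid_cell :: "real ^ 'd \<Rightarrow> int ^ 'd \<Rightarrow> (real ^ 'd) set" where
  "grid_cell h z = {y. \<forall>l. h $ l * real_of_int (z $ l) \<le> y $ l \<and> y $ l < h $ l * (real_of_int (z $ l) + 1)}"

definition cell_index :: "real ^ 'd \<Rightarrow> real ^ 'd \<Rightarrow> int ^ 'd" where
  "cell_index h y = (\<chi> l. \<lfloor>y $ l / h $ l\<rfloor>)"

text \<open>With positive sides the half-open cells partition the space, and
  \<open>cell_index\<close> names the cell of a point. Disjointness and covering arguments reduce to
  this equivalence.\<close>

lemma mem_grid_cell_iff:
  assumes "\<And>l. 0 < h $ l"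
  shows "y \<in> grid_cell h z \<longleftrightarrow> cell_index h y = z"
proof -
  have "h $ l * real_of_int (z $ l) \<le> y $ l \<and> y $ l < h $ l * (real_of_int (z $ l) + 1) \<longleftrightarrow>
        \<lfloor>y $ l / h $ l\<rfloor> = z $ l" for l
    using assms[of l] by (simp add: floor_eq_iff field_simps)
  then show ?thesis
    by (auto simp: grid_cell_def cell_index_def vec_eq_iff)
qed

lemma dist_grid_cell_le:
  assumes "y \<in> grid_cell h z" "y' \<in> grid_cell h z"
  shows "dist y y' \<le> (\<Sum>l\<in>UNIV. h $ l)"
proof -
  have "norm (y - y') \<le> (\<Sum>l\<in>UNIV. \<bar>(y - y') $ l\<bar>)" by (rule norm_le_l1_cart)
  also have "\<dots> \<le> (\<Sum>l\<in>UNIV. h $ l)"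
  proof (rule sum_mono)
    fix l show "\<bar>(y - y') $ l\<bar> \<le> h $ l"
    proof -
      have "h $ l * real_of_int (z $ l) \<le> y $ l" "y $ l < h $ l * (real_of_int (z $ l) + 1)"
        "h $ l * real_of_int (z $ l) \<le> y' $ l" "y' $ l < h $ l * (real_of_int (z $ l) + 1)"
        using assms by (auto simp: grid_cell_def)
      then show ?thesis by (simp add: algebra_simps abs_le_iff)
    qed
  qed
  finally show ?thesis by (simp add: dist_norm)
qed

text \<open>A cell is an intersection of half-spaces. Convexity is wanted because the frontier of a
  convex set is negligible, a property that passes on to cells cut by \<open>C\<close>.\<close>

lemma convex_grid_cell: "convex (grid_cell (h :: real ^ 'd) z)"
proof -
  have "grid_cell h z = (\<Inter>l. {y. y $ l \<ge> h $ l * real_of_int (z $ l)} \<inter> {y. y $ l < h $ l * (real_of_int (z $ l) + 1)})"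
    by (auto simp: grid_cell_def)
  moreover have "convex ({y. y $ l \<ge> h $ l * real_of_int (z $ l)} \<inter> {y. y $ l < h $ l * (real_of_int (z $ l) + 1)})" for l
    using convex_halfspace_ge[of "h $ l * real_of_int (z $ l)" "axis l 1 :: real ^ 'd"]
      convex_halfspace_lt[of "axis l 1 :: real ^ 'd" "h $ l * (real_of_int (z $ l) + 1)"]
    by (intro convex_Int) (simp_all add: inner_axis' inner_real_def)
  ultimately show ?thesis by (metis (mono_tags, lifting) convex_INT)
qed

lemma borel_grid_cell [measurable]: "grid_cell h z \<in> sets borel"
  unfolding grid_cell_def by measurable

lemma grid_cell_subset_cbox:
  "grid_cell h z \<subseteq> cbox (h * real_vec z) (h * (real_vec z + 1))"
  unfolding grid_cell_def by (auto simp: mem_box_cart real_vec_def) (metis less_imp_le)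

lemma box_subset_grid_cell:
  "box (h * real_vec z) (h * (real_vec z + 1)) \<subseteq> grid_cell h z"
  by (auto simp: grid_cell_def mem_box_cart real_vec_def intro: less_imp_le)

text \<open>The half-open cell is squeezed between an open and a closed box of the same
  volume.\<close>

lemma emeasure_grid_cell:
  assumes "\<And>l. 0 < h $ l"
  shows "emeasure lborel (grid_cell h z) = ennreal (\<Prod>l\<in>UNIV. h $ l)"
proof -
  let ?a = "h * real_vec z" and ?b = "h * (real_vec z + 1)"
  have le: "?a $ l \<le> ?b $ l" for l
    using assms[of l] by (simp add: real_vec_def)
  then have le': "?a \<bullet> i \<le> ?b \<bullet> i" if "i \<in> Basis" for i
    using that unfolding cart_eq_inner_axis by (auto simp: Basis_vec_def)
  have ne: "cbox ?a ?b \<noteq> {}"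
    using le by (simp add: interval_ne_empty_cart)
  \<comment> \<open>Lebesgue measure of a box is a product over \<open>Basis\<close>; comparing two
    formulas for the content of the closed box turns it into a product over coordinates.\<close>
  have "(\<Prod>i\<in>Basis. (?b - ?a) \<bullet> i) = measure lborel (cbox ?a ?b)"
    using content_cbox[of ?a ?b] le' by (simp add: inner_diff_left)
  also have "\<dots> = (\<Prod>l\<in>UNIV. ?b $ l - ?a $ l)"
    using content_cbox_cart[OF ne] .
  also have "\<dots> = (\<Prod>l\<in>UNIV. h $ l)" by (simp add: algebra_simps)
  finally have p: "(\<Prod>i\<in>Basis. (?b - ?a) \<bullet> i) = (\<Prod>l\<in>UNIV. h $ l)" .
  have "emeasure lborel (box ?a ?b) \<le> emeasure lborel (grid_cell h z)"
    by (intro emeasure_mono box_subset_grid_cell) simp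
  moreover have "emeasure lborel (grid_cell h z) \<le> emeasure lborel (cbox ?a ?b)"
    by (intro emeasure_mono grid_cell_subset_cbox) simp
  ultimately show ?thesis
    using le' p by (simp add: emeasure_lborel_box_eq emeasure_lborel_cbox_eq antisym)
qed

lemma real_vec_mem_grid_cell: "(\<And>l. 0 < h $ l) \<Longrightarrow> h * real_vec z \<in> grid_cell h z"
  by (simp add: grid_cell_def real_vec_def)

lemma vec_interval_eq_image: "{a..b :: int ^ 'd} = vec_lambda ` (PiE UNIV (\<lambda>l. {a $ l..b $ l}))"
proof -
  have "v \<in> vec_lambda ` (PiE UNIV (\<lambda>l. {a $ l..b $ l}))" if "v \<in> {a..b}" for v
    using that by (intro image_eqI[of _ _ "\<lambda>l. v $ l"]) (auto simp: less_eq_vec_def)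
  moreover have "vec_lambda f \<in> {a..b}" if f: "f \<in> PiE UNIV (\<lambda>l. {a $ l..b $ l})" for f
    using PiE_mem[OF f] by (simp add: less_eq_vec_def)
  ultimately show ?thesis by blast
qed

lemma finite_vec_interval [simp]: "finite {a..b :: int ^ 'd}"
  unfolding vec_interval_eq_image by (intro finite_imageI finite_PiE) auto

text \<open>The assumption says that every factor is nonnegative: a coordinate range may be empty,
  with factor 0, but \<open>nat\<close> must not truncate a negative number.\<close>

lemma card_vec_interval:
  assumes "\<And>l. a $ l \<le> b $ l + 1"
  shows "real (card {a..b :: int ^ 'd}) = (\<Prod>l\<in>UNIV. real_of_int (b $ l - a $ l + 1))"
proof -
  have "inj_on vec_lambda (PiE UNIV (\<lambda>l. {a $ l..b $ l}))"
    by (auto simp: inj_on_def vec_lambda_inject)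
  then have "card {a..b} = (\<Prod>l\<in>UNIV. nat (b $ l - a $ l + 1))"
    unfolding vec_interval_eq_image by (simp add: card_image card_PiE algebra_simps)
  then show ?thesis
    using assms by (simp add: algebra_simps)
qed

lemma finite_cells_meeting_bounded:
  assumes "\<And>l. 0 < h $ l" "bounded U"
  shows "finite {z. grid_cell h z \<inter> U \<noteq> {}}"
proof -
  obtain R where R: "\<And>y. y \<in> U \<Longrightarrow> norm y \<le> R"
    using assms(2) unfolding bounded_iff by auto
  have "{z. grid_cell h z \<inter> U \<noteq> {}} \<subseteq> {(\<chi> l. \<lfloor>- R / h $ l\<rfloor>)..(\<chi> l. \<lfloor>R / h $ l\<rfloor>)}"
  proof
    fix z assume "z \<in> {z. grid_cell h z \<inter> U \<noteq> {}}"
    then obtain y where y: "y \<in> U" "cell_index h y = z"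
      using mem_grid_cell_iff[OF assms(1)] by blast
    have "\<bar>y $ l\<bar> \<le> R" for l
      using component_le_norm_cart[of y l] R[OF y(1)] by simp
    then have "- R \<le> y $ l" "y $ l \<le> R" for l
      by (auto simp: abs_le_iff minus_le_iff)
    then have "- R / h $ l \<le> y $ l / h $ l" "y $ l / h $ l \<le> R / h $ l" for l
      using less_imp_le[OF assms(1)[of l]] by (metis divide_right_mono)+
    then show "z \<in> {(\<chi> l. \<lfloor>- R / h $ l\<rfloor>)..(\<chi> l. \<lfloor>R / h $ l\<rfloor>)}"
      unfolding y(2)[symmetric] by (auto simp: less_eq_vec_def cell_index_def intro: floor_mono)
  qed
  then show ?thesis by (rule finite_subset) simp
qed

lemma measure_UN_grid_cells:
  assumes "\<And>l. 0 < h $ l" "finite S"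
  shows "measure lborel (\<Union>z\<in>S. grid_cell h z) = real (card S) * (\<Prod>l\<in>UNIV. h $ l)"
proof -
  have m: "measure lborel (grid_cell h z) = (\<Prod>l\<in>UNIV. h $ l)" for z
    using emeasure_grid_cell[OF assms(1), of z] assms(1)
    by (simp add: measure_def prod_nonneg less_imp_le)
  have "measure lborel (\<Union>z\<in>S. grid_cell h z) = (\<Sum>z\<in>S. measure lborel (grid_cell h z))"
    using assms emeasure_grid_cell[OF assms(1)]
    by (intro measure_finite_Union) (auto simp: disjoint_family_on_def mem_grid_cell_iff)
  then show ?thesis by (simp add: m)
qed

text \<open>
  The indicator of the union of the cells with index in \<open>S n\<close> converges to the indicator of \<open>U\<close>
  off the frontier of \<open>U\<close>.
\<close>

lemma cell_count_tendsto:
  fixes h :: "nat \<Rightarrow> real ^ 'd" and S :: "nat \<Rightarrow> (int ^ 'd) set"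
  assumes U: "bounded U" "U \<in> sets borel" "negligible (frontier U)"
    and pos: "eventually (\<lambda>n. \<forall>l. 0 < h n $ l) sequentially"
    and lim: "\<And>l. (\<lambda>n. h n $ l) \<longlonglongrightarrow> 0"
    and outer: "eventually (\<lambda>n. \<forall>z\<in>S n. grid_cell (h n) z \<inter> U \<noteq> {}) sequentially"
    and inner: "eventually (\<lambda>n. \<forall>z. grid_cell (h n) z \<subseteq> U \<longrightarrow> z \<in> S n) sequentially"
  shows "(\<lambda>n. real (card (S n)) * (\<Prod>l\<in>UNIV. h n $ l)) \<longlonglongrightarrow> measure lborel U"
proof -
  obtain R where R: "\<And>y. y \<in> U \<Longrightarrow> norm y \<le> R"
    using U(1) unfolding bounded_iff by auto
  define W where "W n = (\<Union>z\<in>S n. grid_cell (h n) z)" for n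
  \<comment> \<open>Eventually the cells have diameter below 1, so those meeting \<open>U\<close>
    lie in this ball. Cutting \<open>W n\<close> with it yields one dominating function for all n,
    including the indices where the eventual hypotheses fail.\<close>
  define B where "B = cball (0 :: real ^ 'd) (R + 1)"
  have sum_lim: "(\<lambda>n. \<Sum>l\<in>UNIV. h n $ l) \<longlonglongrightarrow> 0"
    using tendsto_sum[of UNIV "\<lambda>l n. h n $ l" "\<lambda>_. 0" sequentially] lim by simp
  have small: "eventually (\<lambda>n. (\<Sum>l\<in>UNIV. h n $ l) < e) sequentially" if "e > 0" for e
    using order_tendstoD(2)[OF sum_lim that] .
  have W_sets: "W n \<in> sets borel" for n
  proof -
    have "countable (S n)" by (rule countableI_type)
    then show ?thesis unfolding W_def by (intro sets.countable_UN') auto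
  qed
  have U_sets: "U \<in> sets lborel" using U(2) by simp
  have frontier_null: "AE y in lborel. y \<notin> frontier U"
  proof -
    have "frontier U \<in> null_sets lborel"
      using U(3) by (simp add: negligible_iff_null_sets null_sets_completion_iff frontier_closed borel_closed)
    then show ?thesis by (rule AE_not_in)
  qed
  have "(\<lambda>n. integral\<^sup>L lborel (indicator (W n \<inter> B) :: _ \<Rightarrow> real))
      \<longlonglongrightarrow> integral\<^sup>L lborel (indicator U :: _ \<Rightarrow> real)"
  proof (rule integral_dominated_convergence)
    show "integrable lborel (indicator B :: _ \<Rightarrow> real)"
      unfolding B_def by (intro integrable_real_indicator) (use emeasure_lborel_cball_finite in \<open>auto simp: top.not_eq_extremum\<close>)
    show "AE y in lborel. norm (indicator (W n \<inter> B) y :: real) \<le> indicator B y" for n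
      by (auto simp: indicator_def)
    show "AE y in lborel. (\<lambda>n. indicator (W n \<inter> B) y :: real) \<longlonglongrightarrow> indicator U y"
      using frontier_null
    proof eventually_elim
      case (elim y)
      \<comment> \<open>Off the frontier a ball about \<open>y\<close> lies inside or outside
        \<open>U\<close>. Once the sum of the sides is below its radius, the cell of
        \<open>y\<close> stays in the ball, and \<open>inner\<close> or \<open>outer\<close> decides
        whether it is counted.\<close>
      then consider "y \<in> interior U" | "y \<in> - closure U" by (auto simp: frontier_def)
      then show ?case
      proof cases
        case 1
        then obtain e where e: "e > 0" "ball y e \<subseteq> interior U"
          using open_contains_ball open_interior by blast
        have "y \<in> U" using 1 interior_subset by blast
        have "eventually (\<lambda>n. indicator (W n \<inter> B) y = (1 :: real)) sequentially"
          using pos small[OF e(1)] inner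
        proof eventually_elim
          case (elim n)
          let ?z = "cell_index (h n) y"
          have y: "y \<in> grid_cell (h n) ?z" using elim(1) by (simp add: mem_grid_cell_iff)
          have "grid_cell (h n) ?z \<subseteq> ball y e"
            using dist_grid_cell_le[OF y] elim(2) by (fastforce intro: le_less_trans)
          then have "grid_cell (h n) ?z \<subseteq> U" using e(2) interior_subset by blast
          then have "?z \<in> S n" using elim(3) by blast
          then have "y \<in> W n" using y unfolding W_def by blast
          moreover have "y \<in> B" using R[OF \<open>y \<in> U\<close>] unfolding B_def by simp
          ultimately show ?case by simp
        qed
        then show ?thesis using \<open>y \<in> U\<close> by (simp add: tendsto_eventually)
      next
        case 2
        then obtain e where e: "e > 0" "ball y e \<subseteq> - closure U"
          using open_contains_ball closed_closure open_Compl by metis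
        have "y \<notin> U" using 2 closure_subset by blast
        have "eventually (\<lambda>n. indicator (W n \<inter> B) y = (0 :: real)) sequentially"
          using pos small[OF e(1)] outer
        proof eventually_elim
          case (elim n)
          have "y \<notin> W n"
          proof
            assume "y \<in> W n"
            then obtain z where z: "z \<in> S n" "y \<in> grid_cell (h n) z" unfolding W_def by blast
            have "grid_cell (h n) z \<subseteq> ball y e"
              using dist_grid_cell_le[OF z(2)] elim(2) by (fastforce intro: le_less_trans)
            then have "grid_cell (h n) z \<inter> U = {}" using e(2) closure_subset by blast
            then show False using elim(3) z(1) by blast
          qed
          then show ?case by simp
        qed
        then show ?thesis using \<open>y \<notin> U\<close> by (simp add: tendsto_eventually)
      qed
    qed
  qed (use U_sets W_sets in \<open>auto simp: B_def intro!: borel_measurable_indicator sets.Int\<close>)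
  then have "(\<lambda>n. measure lborel (W n \<inter> B)) \<longlonglongrightarrow> measure lborel U"
    by simp
  moreover have "eventually (\<lambda>n. measure lborel (W n \<inter> B) = real (card (S n)) * (\<Prod>l\<in>UNIV. h n $ l)) sequentially"
    using pos small[OF zero_less_one] outer
  proof eventually_elim
    case (elim n)
    have "finite (S n)"
      by (rule finite_subset[OF _ finite_cells_meeting_bounded[of "h n" U]]) (use elim U in auto)
    moreover have "W n \<subseteq> B"
    proof
      fix y assume "y \<in> W n"
      then obtain z where z: "z \<in> S n" "y \<in> grid_cell (h n) z" unfolding W_def by blast
      then obtain y' where y': "y' \<in> U" "y' \<in> grid_cell (h n) z" using elim(3) by blast
      have "norm y \<le> norm y' + dist y y'"
        by (metis add.commute dist_norm norm_triangle_sub)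
      also have "\<dots> \<le> R + 1"
        using R[OF y'(1)] dist_grid_cell_le[OF z(2) y'(2)] elim(2) by simp
      finally show "y \<in> B" by (simp add: B_def)
    qed
    ultimately show ?case
      using measure_UN_grid_cells[of "h n" "S n"] elim(1) by (simp add: W_def Int_absorb2)
  qed
  ultimately show ?thesis by (rule Lim_transform_eventually)
qed

section \<open>Lattice points of a dilated set as indices of cells of side 1 / c\<close>

lemma mem_lattice_points_vec_scale:
  assumes "\<And>l. 0 < c $ l"
  shows "z \<in> lattice_points (vec_scale c U) \<longleftrightarrow> vec_quot (real_vec z) c \<in> U"
proof
  assume "z \<in> lattice_points (vec_scale c U)"
  then obtain a where a: "a \<in> U" "real_vec z = c * a"
    by (auto simp: lattice_points_def vec_scale_def)
  have "vec_quot (c * a) c = a"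
    using assms by (simp add: vec_quot_def vec_eq_iff less_imp_neq[THEN not_sym])
  then show "vec_quot (real_vec z) c \<in> U" using a by simp
next
  assume "vec_quot (real_vec z) c \<in> U"
  moreover have "real_vec z = c * vec_quot (real_vec z) c"
    using assms by (simp add: vec_quot_def vec_eq_iff less_imp_neq[THEN not_sym])
  ultimately show "z \<in> lattice_points (vec_scale c U)"
    unfolding lattice_points_def vec_scale_def by blast
qed

text \<open>The scaled lattice point is the lower corner of the cell with the same index, so
  counting lattice points becomes counting cells.\<close>

lemma vec_quot_mem_grid_cell:
  assumes "\<And>l. 0 < c $ l"
  shows "vec_quot (real_vec z) c \<in> grid_cell (vec_quot 1 c) z"
  unfolding grid_cell_def
proof (intro CollectI allI)
  fix l
  show "vec_quot 1 c $ l * real_of_int (z $ l) \<le> vec_quot (real_vec z) c $ l \<and>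
      vec_quot (real_vec z) c $ l < vec_quot 1 c $ l * (real_of_int (z $ l) + 1)"
    using assms[of l] by (simp add: vec_quot_def real_vec_def field_simps)
qed

lemma finite_lattice_points_vec_scale:
  assumes c: "\<And>l. 0 < c $ l" and "bounded U"
  shows "finite (lattice_points (vec_scale c U))"
proof (rule finite_subset)
  show "lattice_points (vec_scale c U) \<subseteq> {z. grid_cell (vec_quot 1 c) z \<inter> U \<noteq> {}}"
    using vec_quot_mem_grid_cell[OF c] unfolding mem_lattice_points_vec_scale[OF c] subset_iff by blast
  show "finite {z. grid_cell (vec_quot 1 c) z \<inter> U \<noteq> {}}"
    using assms by (intro finite_cells_meeting_bounded) (auto simp: vec_quot_def)
qed

text \<open>The indices z with z / c in \<open>U\<close> include those of all cells inside
  \<open>U\<close> and belong to cells meeting \<open>U\<close>, so the general cell count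
  applies.\<close>

lemma lattice_count_tendsto:
  fixes c :: "nat \<Rightarrow> real ^ 'd"
  assumes U: "bounded U" "U \<in> sets borel" "negligible (frontier U)"
    and pos: "\<And>n l. 0 < c n $ l" and lim: "\<And>l. filterlim (\<lambda>n. c n $ l) at_top sequentially"
  shows "(\<lambda>n. real (card (lattice_points (vec_scale (c n) U))) / (\<Prod>l\<in>UNIV. c n $ l)) \<longlonglongrightarrow> measure lborel U"
proof -
  have "(\<lambda>n. real (card (lattice_points (vec_scale (c n) U))) * (\<Prod>l\<in>UNIV. vec_quot 1 (c n) $ l))
      \<longlonglongrightarrow> measure lborel U"
  proof (rule cell_count_tendsto[OF U])
    show "(\<lambda>n. vec_quot 1 (c n) $ l) \<longlonglongrightarrow> 0" for l
      using tendsto_inverse_0_at_top[OF lim[of l]] by (simp add: vec_quot_def divide_inverse)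
    show "\<forall>\<^sub>F n in sequentially. \<forall>z\<in>lattice_points (vec_scale (c n) U). grid_cell (vec_quot 1 (c n)) z \<inter> U \<noteq> {}"
      by (intro always_eventually allI impI ballI)
        (metis mem_lattice_points_vec_scale[OF pos] vec_quot_mem_grid_cell[OF pos] disjoint_iff subsetD)
    show "\<forall>\<^sub>F n in sequentially. \<forall>z. grid_cell (vec_quot 1 (c n)) z \<subseteq> U \<longrightarrow> z \<in> lattice_points (vec_scale (c n) U)"
      by (intro always_eventually allI impI ballI)
        (metis mem_lattice_points_vec_scale[OF pos] vec_quot_mem_grid_cell[OF pos] disjoint_iff subsetD)
  qed (simp_all add: vec_quot_def pos U)
  then show ?thesis
    by (simp add: vec_quot_def prod_dividef)
qed

section \<open>Shortened blocks\<close>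

text \<open>The gap \<open>g\<close> is removed at the upper faces only, which already separates
  neighbouring blocks and keeps all blocks translates of the one at the origin. The final -1 turns
  the half-open range into a closed integer interval.\<close>

definition trimmed_block :: "int ^ 'd \<Rightarrow> int ^ 'd \<Rightarrow> int ^ 'd \<Rightarrow> (int ^ 'd) set" where
  "trimmed_block T g z = {T * z..T * z + T - g - 1}"

lemma finite_trimmed_block [simp]: "finite (trimmed_block T g z)"
  by (simp add: trimmed_block_def)

lemma mem_trimmed_block:
  "v \<in> trimmed_block T g z \<longleftrightarrow> (\<forall>l. T $ l * z $ l \<le> v $ l \<and> v $ l < T $ l * z $ l + T $ l - g $ l)"
  by (auto simp: trimmed_block_def less_eq_vec_def)

lemma card_trimmed_block:
  assumes "\<And>l. g $ l \<le> T $ l"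
  shows "real (card (trimmed_block T g z)) = (\<Prod>l\<in>UNIV. real_of_int (T $ l - g $ l))"
  unfolding trimmed_block_def by (subst card_vec_interval) (use assms in auto)

lemma trimmed_block_translate: "trimmed_block T g z = (\<lambda>v. v + T * z) ` trimmed_block T g 0"
proof -
  have "v \<in> (\<lambda>v. v + T * z) ` trimmed_block T g 0" if "v \<in> trimmed_block T g z" for v
    using that by (intro image_eqI[of _ _ "v - T * z"]) (auto simp: mem_trimmed_block algebra_simps)
  then show ?thesis by (auto simp: mem_trimmed_block algebra_simps)
qed

text \<open>After scaling by 1 / c the block sits in the cell with the same index. Disjointness of
  blocks and their inclusion in \<open>U\<close> are then read off from the cells.\<close>

lemma trimmed_block_in_cell:
  assumes v: "v \<in> trimmed_block T g z" and g: "\<And>l. 0 \<le> g $ l" and c: "\<And>l. 0 < c $ l"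
  shows "vec_quot (real_vec v) c \<in> grid_cell (vec_quot (real_vec T) c) z"
proof -
  have "T $ l * z $ l \<le> v $ l" "v $ l < T $ l * (z $ l + 1)" for l
    using v g[of l] by (auto simp: mem_trimmed_block algebra_simps) (smt (verit))
  then have "real_of_int (T $ l) * real_of_int (z $ l) \<le> real_of_int (v $ l)"
    "real_of_int (v $ l) < real_of_int (T $ l) * (real_of_int (z $ l) + 1)" for l
    by (metis of_int_le_iff of_int_mult, metis of_int_less_iff of_int_mult of_int_add of_int_1)
  then show ?thesis
    using c by (auto simp: grid_cell_def vec_quot_def real_vec_def divide_right_mono less_imp_le divide_strict_right_mono)
qed

text \<open>The link to \<open>D_plus\<close>: its inclusion in \<open>K\<close> is what makes
  condition D available for unions of blocks.\<close>

lemma trimmed_block_in_block_I: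
  assumes v: "v \<in> trimmed_block T g z" and g: "\<And>l. 0 \<le> g $ l" and T: "\<And>l. 0 < T $ l"
    and side: "block_side c k = real_vec T"
  shows "real_vec v \<in> block_I c k z"
proof -
  let ?u = "vec_quot (real_vec v) (real_vec T) - real_vec z"
  have "T $ l * z $ l \<le> v $ l" "v $ l < T $ l * (z $ l + 1)" for l
    using v g[of l] by (auto simp: mem_trimmed_block algebra_simps) (smt (verit))
  then have "real_of_int (T $ l) * real_of_int (z $ l) \<le> real_of_int (v $ l)"
    "real_of_int (v $ l) < real_of_int (T $ l) * (real_of_int (z $ l) + 1)" for l
    by (metis of_int_le_iff of_int_mult, metis of_int_less_iff of_int_mult of_int_add of_int_1)
  then have "0 \<le> ?u $ l \<and> ?u $ l < 1" for l
    using T[of l] by (simp add: vec_quot_def real_vec_def field_simps)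
  moreover have "real_vec v = real_vec T * (real_vec z + ?u)"
    using T by (simp add: vec_eq_iff vec_quot_def real_vec_def less_imp_neq[THEN not_sym])
  ultimately show ?thesis
    unfolding block_I_def side vec_scale_def by blast
qed

text \<open>Blocks with different indices differ in some coordinate l, where their points are more
  than \<open>g $ l\<close> apart, whereas every point of \<gamma> B(1) has l-th coordinate of
  modulus at most |\<open>\<gamma> $ l\<close>|.\<close>

lemma separated_trimmed_blocks:
  assumes "z \<notin> Y" and \<gamma>: "\<And>l. \<bar>\<gamma> $ l\<bar> \<le> real_of_int (g $ l)" and T: "\<And>l. 0 \<le> T $ l"
  shows "separated \<gamma> (trimmed_block T g z) (\<Union>y\<in>Y. trimmed_block T g y)"
  unfolding separated_def
proof (intro subsetI ComplI)
  fix w' assume w': "w' \<in> real_vec ` (\<Union>y\<in>Y. trimmed_block T g y)"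
    and "w' \<in> real_vec ` trimmed_block T g z + vec_scale \<gamma> (cball 0 1)"
  then obtain u b where u: "u \<in> trimmed_block T g z" and b: "norm b \<le> 1" "w' = real_vec u + \<gamma> * b"
    by (auto simp: vec_scale_def elim!: set_plus_elim)
  obtain y w where y: "y \<in> Y" "w \<in> trimmed_block T g y" "w' = real_vec w" using w' by auto
  have "\<bar>real_of_int (w $ l - u $ l)\<bar> \<le> real_of_int (g $ l)" for l
  proof -
    have "real_of_int (w $ l - u $ l) = \<gamma> $ l * b $ l"
      using b(2) unfolding y(3) by (simp add: vec_eq_iff real_vec_def)
    moreover have "\<bar>\<gamma> $ l * b $ l\<bar> \<le> \<bar>\<gamma> $ l\<bar>"
      using component_le_norm_cart[of b l] b(1) by (simp add: abs_mult mult_left_le)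
    ultimately show ?thesis using \<gamma>[of l] by linarith
  qed
  then have close: "\<bar>w $ l - u $ l\<bar> \<le> g $ l" for l
    by (metis of_int_abs of_int_le_iff)
  obtain l where l: "z $ l \<noteq> y $ l" using \<open>z \<notin> Y\<close> y(1) by (metis vec_eq_iff)
  have u': "T $ l * z $ l \<le> u $ l" "u $ l < T $ l * z $ l + T $ l - g $ l"
    and w'': "T $ l * y $ l \<le> w $ l" "w $ l < T $ l * y $ l + T $ l - g $ l"
    using u y(2) by (auto simp: mem_trimmed_block)
  show False
  proof (cases "z $ l < y $ l")
    case True
    then have "T $ l * (z $ l + 1) \<le> T $ l * y $ l" using T by (intro mult_left_mono) auto
    then show False using u' w'' close[of l] by (simp add: algebra_simps)
  next
    case False
    then have "T $ l * (y $ l + 1) \<le> T $ l * z $ l" using T l by (intro mult_left_mono) auto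
    then show False using u' w'' close[of l] by (simp add: algebra_simps)
  qed
qed

lemma is_box_trimmed_block: "is_box (trimmed_block T g z)"
  by (auto simp: is_box_def trimmed_block_def)

lemma mem_A_set_zero:
  assumes T: "\<And>l. 0 < T $ l" and side: "block_side c k = real_vec T"
    and v: "\<And>l. \<bar>v $ l\<bar> \<le> T $ l" "(0, v) \<in> r" "v \<noteq> 0"
  shows "v \<in> A_set r c k 0"
proof -
  let ?u = "vec_quot (real_vec v) (real_vec T)"
  have "- 1 \<le> ?u $ l \<and> ?u $ l \<le> 1" for l
    using T[of l] v(1)[of l] by (simp add: vec_quot_def real_vec_def field_simps abs_le_iff)
  moreover have "real_vec v = real_vec 0 + real_vec T * ?u"
    using T by (simp add: vec_eq_iff vec_quot_def real_vec_def less_imp_neq[THEN not_sym])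
  ultimately have "real_vec v \<in> (\<lambda>u. real_vec 0 + u) `
      vec_scale (block_side c k) {u. \<forall>l. - 1 \<le> u $ l \<and> u $ l \<le> 1}"
    unfolding side vec_scale_def by blast
  then show ?thesis using v by (auto simp: A_set_def lattice_points_def)
qed

section \<open>Void probabilities of a stationary field\<close>

locale stationary_random_field = prob_space M
  for M :: "'a measure" +
  fixes \<xi> :: "int ^ 'd \<Rightarrow> 'a \<Rightarrow> real"
  assumes stationary: "stationary_field M \<xi>"
begin

definition void :: "real \<Rightarrow> (int ^ 'd) set \<Rightarrow> 'a set" where
  "void x A = {\<omega> \<in> space M. \<forall>v\<in>A. \<xi> v \<omega> \<le> x}"

lemma measurable_field [measurable]: "\<xi> v \<in> borel_measurable M"
  using stationary by (simp add: stationary_field_def)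

lemma void_sets [measurable]: "void x A \<in> events"
proof -
  have "countable A" by (rule countableI_type)
  then show ?thesis unfolding void_def
    by (intro sets.sets_Collect_countable_Ball) measurable
qed

lemma field_max_event: "{\<omega> \<in> space M. field_max \<xi> A \<omega> \<le> ereal x} = void x A"
  by (simp add: field_max_def void_def SUP_le_iff)

lemma prob_shift:
  assumes E: "E \<in> sets (Pi\<^sub>M UNIV (\<lambda>_. borel))"
  shows "prob {\<omega> \<in> space M. (\<lambda>v. \<xi> (v + h) \<omega>) \<in> E} = prob {\<omega> \<in> space M. (\<lambda>v. \<xi> v \<omega>) \<in> E}"
proof -
  have m: "(\<lambda>\<omega> v. \<xi> (v + h) \<omega>) \<in> measurable M (Pi\<^sub>M UNIV (\<lambda>_. borel))" for h
    by (rule measurable_PiM_single') (auto simp: PiE_def)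
  have m0: "(\<lambda>\<omega> v. \<xi> v \<omega>) \<in> measurable M (Pi\<^sub>M UNIV (\<lambda>_. borel))"
    using m[of 0] by simp
  have "measure (distr M (Pi\<^sub>M UNIV (\<lambda>_. borel)) (\<lambda>\<omega> v. \<xi> (v + h) \<omega>)) E =
        measure (distr M (Pi\<^sub>M UNIV (\<lambda>_. borel)) (\<lambda>\<omega> v. \<xi> v \<omega>)) E"
    using stationary by (simp add: stationary_field_def)
  then show ?thesis
    by (simp add: measure_distr[OF m E] measure_distr[OF m0 E] vimage_def Int_def conj_commute)
qed

lemma product_event:
  "{f. \<forall>v\<in>A. f v \<le> (x::real)} \<in> sets (Pi\<^sub>M (UNIV :: (int ^ 'd) set) (\<lambda>_. borel))"
proof -
  have "countable A" by (rule countableI_type)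
  then have "{f \<in> space (Pi\<^sub>M UNIV (\<lambda>_. borel)). \<forall>v\<in>A. f v \<le> x} \<in> sets (Pi\<^sub>M UNIV (\<lambda>_. borel))"
    by (intro sets.sets_Collect_countable_Ball) measurable
  then show ?thesis by (simp add: space_PiM)
qed

lemma prob_void_translate: "prob (void x ((\<lambda>v. v + h) ` A)) = prob (void x A)"
  using prob_shift[OF product_event[of A x], of h] by (simp add: void_def)

lemma exceed_event:
  "{f. f 0 > (x::real) \<and> (\<forall>v\<in>A. f v \<le> x)} \<in> sets (Pi\<^sub>M (UNIV :: (int ^ 'd) set) (\<lambda>_. borel))"
proof -
  have "{f \<in> space (Pi\<^sub>M (UNIV :: (int ^ 'd) set) (\<lambda>_. borel)). f 0 > x} \<in> sets (Pi\<^sub>M UNIV (\<lambda>_. borel))"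
    by measurable
  from sets.Int[OF this product_event[of A x]] show ?thesis
    by (simp add: space_PiM Int_def)
qed

text \<open>With \<open>A\<close> as a set of relative positions, the event that a site exceeds and
  none of the sites at these positions does is equally likely for every site.\<close>

lemma prob_exceed_translate:
  "prob {\<omega> \<in> space M. \<xi> h \<omega> > x \<and> (\<forall>v\<in>A. \<xi> (v + h) \<omega> \<le> x)} =
   prob {\<omega> \<in> space M. \<xi> 0 \<omega> > x \<and> (\<forall>v\<in>A. \<xi> v \<omega> \<le> x)}"
  using prob_shift[OF exceed_event[of x A], of h] by simp

lemma prob_exceed_eq: "prob {\<omega> \<in> space M. \<xi> h \<omega> > x} = prob {\<omega> \<in> space M. \<xi> 0 \<omega> > x}"
  using prob_exceed_translate[of x h "{}"] by simp

text \<open>A union bound with two uses: for empty \<open>A\<close> it bounds the probability of an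
  exceedance in a block from above, and it later shows that gaps and boundary parts may be
  discarded.\<close>

lemma prob_void_diff_le:
  assumes "A \<subseteq> B" "finite (B - A)"
  shows "prob (void x A) - prob (void x B) \<le> real (card (B - A)) * prob {\<omega> \<in> space M. \<xi> 0 \<omega> > x}"
proof -
  have "void x A \<subseteq> void x B \<union> (\<Union>v\<in>B - A. {\<omega> \<in> space M. \<xi> v \<omega> > x})"
    by (auto simp: void_def not_le[symmetric])
  then have "prob (void x A) \<le> prob (void x B \<union> (\<Union>v\<in>B - A. {\<omega> \<in> space M. \<xi> v \<omega> > x}))"
    using assms by (intro finite_measure_mono) auto
  also have "\<dots> \<le> prob (void x B) + prob (\<Union>v\<in>B - A. {\<omega> \<in> space M. \<xi> v \<omega> > x})"
    using assms by (intro measure_Un_le) auto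
  also have "prob (\<Union>v\<in>B - A. {\<omega> \<in> space M. \<xi> v \<omega> > x}) \<le> (\<Sum>v\<in>B - A. prob {\<omega> \<in> space M. \<xi> v \<omega> > x})"
    using assms by (intro finite_measure_subadditive_finite) auto
  also have "\<dots> = (\<Sum>v\<in>B - A. prob {\<omega> \<in> space M. \<xi> 0 \<omega> > x})"
    by (intro sum.cong refl prob_exceed_eq)
  finally show ?thesis by simp
qed

lemma prob_void_antimono: "A \<subseteq> B \<Longrightarrow> prob (void x B) \<le> prob (void x A)"
  by (intro finite_measure_mono) (auto simp: void_def)

lemma prob_void_empty [simp]: "prob (void x {}) = 1"
  by (simp add: void_def prob_space)

text \<open>
  An exceedance in \<open>J\<close> is decomposed according to the position of the last one in the order \<open>r\<close>.
\<close>

lemma prob_void_last_exceedance: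
  assumes r: "translation_invariant_order r" and J: "finite J"
    and A: "\<And>v w. v \<in> J \<Longrightarrow> w \<in> J \<Longrightarrow> (v, w) \<in> r \<Longrightarrow> v \<noteq> w \<Longrightarrow> w - v \<in> A"
  shows "real (card J) * prob {\<omega> \<in> space M. \<xi> 0 \<omega> > x \<and> (\<forall>v\<in>A. \<xi> v \<omega> \<le> x)} \<le> 1 - prob (void x J)"
proof -
  define E where "E v = {\<omega> \<in> space M. \<xi> v \<omega> > x \<and> (\<forall>w\<in>A. \<xi> (w + v) \<omega> \<le> x)}" for v
  have tot: "(v, w) \<in> r \<or> (w, v) \<in> r" if "v \<noteq> w" for v w
    using r that by (auto simp: translation_invariant_order_def linear_order_on_def total_on_def)
  have E_sets: "E v \<in> events" for v
  proof -
    have "E v = {\<omega> \<in> space M. \<xi> v \<omega> > x} \<inter> void x ((\<lambda>w. w + v) ` A)"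
      by (auto simp: E_def void_def)
    then show ?thesis by simp
  qed
  \<comment> \<open>By totality one of the two sites precedes the other, and the later one, which
    exceeds on its own event, is among the sites where the earlier event forbids
    exceedances.\<close>
  have "E v \<inter> E w = {}" if vw: "v \<in> J" "w \<in> J" "v \<noteq> w" for v w
    using tot[OF vw(3)] A[OF vw(1,2) _ vw(3)] A[OF vw(2,1) _ vw(3)[symmetric]]
    by (fastforce simp: E_def)
  then have disj: "disjoint_family_on E J" by (auto simp: disjoint_family_on_def)
  have "real (card J) * prob (E 0) = (\<Sum>v\<in>J. prob (E v))"
    unfolding E_def by (subst prob_exceed_translate) simp
  also have "\<dots> = prob (\<Union>v\<in>J. E v)"
    using E_sets disj J by (intro finite_measure_finite_Union[symmetric]) auto
  also have "\<dots> \<le> prob (space M - void x J)"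
    using E_sets J by (intro finite_measure_mono) (auto simp: E_def void_def not_le)
  also have "\<dots> = 1 - prob (void x J)" by (simp add: prob_compl)
  finally show ?thesis by (simp add: E_def)
qed

text \<open>Blocks are split off one at a time, so one of the two sets compared is always a single
  block. Each split costs \<open>a\<close>, and multiplication by q, which lies in [0,1], does not
  enlarge the error inherited from the remaining blocks.\<close>

lemma prob_void_blocks:
  assumes "finite Z" and q: "\<And>z. z \<in> Z \<Longrightarrow> prob (void x (J z)) = q"
    and D: "\<And>z Y. z \<in> Z \<Longrightarrow> Y \<subseteq> Z - {z} \<Longrightarrow>
      \<bar>prob (void x (J z \<union> (\<Union>y\<in>Y. J y))) - prob (void x (J z)) * prob (void x (\<Union>y\<in>Y. J y))\<bar> \<le> a"
  shows "\<bar>prob (void x (\<Union>z\<in>Z. J z)) - q ^ card Z\<bar> \<le> real (card Z) * a"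
proof -
  have "\<bar>prob (void x (\<Union>z\<in>Y. J z)) - q ^ card Y\<bar> \<le> real (card Y) * a" if "Y \<subseteq> Z" for Y
    using finite_subset[OF that \<open>finite Z\<close>] that
  proof (induction Y rule: finite_induct)
    case (insert z Y)
    have qz: "prob (void x (J z)) = q" using insert.prems q by simp
    have "0 \<le> q" "q \<le> 1" using qz by auto
    let ?P = "prob (void x (\<Union>y\<in>Y. J y))"
    have "\<bar>q * ?P - q * q ^ card Y\<bar> \<le> \<bar>?P - q ^ card Y\<bar>"
      using \<open>0 \<le> q\<close> \<open>q \<le> 1\<close> by (simp add: right_diff_distrib[symmetric] abs_mult mult_left_le_one_le)
    moreover have "\<bar>?P - q ^ card Y\<bar> \<le> real (card Y) * a" using insert by simp
    moreover have "\<bar>prob (void x (J z \<union> (\<Union>y\<in>Y. J y))) - q * ?P\<bar> \<le> a"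
      using D[of z Y] insert.prems insert.hyps by (auto simp: qz)
    ultimately show ?case
      using insert.hyps by (simp add: algebra_simps)
  qed simp
  then show ?thesis by simp
qed

end

section \<open>Elementary limits\<close>

lemma power_one_minus_tendsto:
  fixes a :: "nat \<Rightarrow> real" and N :: "nat \<Rightarrow> nat"
  assumes "\<And>n. 0 \<le> a n" "a \<longlonglongrightarrow> 0" "(\<lambda>n. real (N n) * a n) \<longlonglongrightarrow> s"
  shows "(\<lambda>n. (1 - a n) ^ N n) \<longlonglongrightarrow> exp (- s)"
proof (rule tendsto_sandwich)
  have ev: "eventually (\<lambda>n. a n < 1) sequentially"
    using order_tendstoD(2)[OF assms(2)] by simp
  show "\<forall>\<^sub>F n in sequentially. exp (- (real (N n) * a n / (1 - a n))) \<le> (1 - a n) ^ N n"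
    using ev
  proof eventually_elim
    case (elim n)
    \<comment> \<open>Applying 1 + y \<le> exp y to y = a / (1 - a) bounds 1 - a from below by an
      exponential. Together with 1 - a \<le> exp (- a) this avoids logarithms, and both exponents
      times \<open>N n\<close> have the same limit.\<close>
    have "1 / (1 - a n) = 1 + a n / (1 - a n)" using elim by (simp add: field_simps)
    also have "\<dots> \<le> exp (a n / (1 - a n))" by (rule exp_ge_add_one_self)
    finally have "exp (- (a n / (1 - a n))) \<le> 1 - a n"
      using elim by (simp add: exp_minus field_simps)
    then have "exp (- (a n / (1 - a n))) ^ N n \<le> (1 - a n) ^ N n"
      by (intro power_mono) auto
    then show ?case by (simp add: exp_of_nat_mult[symmetric])
  qed
  show "\<forall>\<^sub>F n in sequentially. (1 - a n) ^ N n \<le> exp (- (real (N n) * a n))"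
    using ev
  proof eventually_elim
    case (elim n)
    have "(1 - a n) ^ N n \<le> exp (- a n) ^ N n"
      using exp_ge_add_one_self[of "- a n"] elim by (intro power_mono) auto
    then show ?case by (simp add: exp_of_nat_mult[symmetric])
  qed
  show "(\<lambda>n. exp (- (real (N n) * a n))) \<longlonglongrightarrow> exp (- s)"
    by (intro tendsto_intros assms)
  show "(\<lambda>n. exp (- (real (N n) * a n / (1 - a n)))) \<longlonglongrightarrow> exp (- s)"
    using tendsto_exp[OF tendsto_minus[OF tendsto_divide[OF assms(3) tendsto_diff[OF tendsto_const assms(2)]]], of 1]
    by simp
qed

lemma filterlim_root_at_top:
  assumes "0 < d" "filterlim f at_top F"
  shows "filterlim (\<lambda>n. root d (f n)) at_top F"
  unfolding filterlim_at_top_gt[where c = 0]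
proof (intro allI impI)
  fix Z :: real assume "0 < Z"
  have "eventually (\<lambda>n. Z ^ d \<le> f n) F"
    using assms(2) by (simp add: filterlim_at_top)
  then show "eventually (\<lambda>n. Z \<le> root d (f n)) F"
  proof eventually_elim
    case (elim n)
    then have "root d (Z ^ d) \<le> root d (f n)" using assms(1) by simp
    then show ?case using \<open>0 < Z\<close> assms(1) by (simp add: real_root_power_cancel)
  qed
qed

lemma tendsto_floor_ratio:
  assumes "filterlim X at_top F"
  shows "((\<lambda>n. real_of_int \<lfloor>X n\<rfloor> / X n) \<longlongrightarrow> 1) F"
proof -
  have "((\<lambda>y::real. real_of_int \<lfloor>y\<rfloor> / y) \<longlongrightarrow> 1) at_top" by real_asymp
  from filterlim_compose[OF this assms] show ?thesis .
qed

context stationary_random_field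
begin

text \<open>
  The blocks inside \<open>U\<close> are shortened by \<open>g = \<lceil>\<bar>\<gamma>\<bar>\<rceil>\<close> in every coordinate, which makes them
  separated and changes neither the void probability nor the expected number of exceedances in
  the limit.
\<close>

lemma prob_void_tendsto:
  fixes C U :: "(real ^ 'd) set" and c :: "nat \<Rightarrow> real ^ 'd"
    and x :: "nat \<Rightarrow> real" and k :: "nat \<Rightarrow> nat" and K :: "nat \<Rightarrow> (int ^ 'd) set"
    and \<gamma> :: "nat \<Rightarrow> real ^ 'd" and \<alpha> :: "nat \<Rightarrow> real"
  assumes c_pos: "\<And>n l. 0 < c n $ l" and c_lim: "\<And>l. filterlim (\<lambda>n. c n $ l) at_top sequentially"
    and ord: "translation_invariant_order ord"
    and k_pos: "\<And>n. 0 < k n" and k_lim: "filterlim k at_top sequentially"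
    and k_small: "vec_small_o (\<lambda>n. \<chi> l. root CARD('d) (real (k n))) c"
    and K: "\<And>n. D_plus C (c n) (k n) \<subseteq> K n"
    and D: "condition_D M \<xi> c x K \<gamma> \<alpha>"
    and k\<alpha>: "(\<lambda>n. real (k n) * \<alpha> n) \<longlonglongrightarrow> 0"
    and k\<gamma>: "vec_small_o (\<lambda>n. root CARD('d) (real (k n)) *\<^sub>R \<gamma> n) c"
    and local: "condition_D_local M \<xi> ord c x k"
    and \<tau>: "0 < \<tau>" "(\<lambda>n. prob {\<omega> \<in> space M. \<xi> 0 \<omega> > x n} * (\<Prod>l\<in>UNIV. c n $ l)) \<longlonglongrightarrow> \<tau>"
    and U: "U \<subseteq> C" "bounded U" "U \<in> sets borel" "negligible (frontier U)"
  shows "(\<lambda>n. prob (void (x n) (lattice_points (vec_scale (c n) U)))) \<longlonglongrightarrow> exp (- (\<tau> * measure lborel U))"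
proof -
  define rt where "rt n = root CARD('d) (real (k n))" for n
  \<comment> \<open>\<open>X\<close> is the block side before rounding, \<open>T\<close> its integer
    part, \<open>g\<close> an integer gap dominating \<gamma>, and \<open>h\<close> the block side
    after scaling by 1 / c.\<close>
  define X where "X l n = c n $ l / rt n" for l n
  define T where "T n = (\<chi> l. \<lfloor>X l n\<rfloor>)" for n
  define g where "g n = (\<chi> l. \<lceil>\<bar>\<gamma> n $ l\<bar>\<rceil>)" for n
  define h where "h n = vec_quot (real_vec (T n)) (c n)" for n
  \<comment> \<open>Only blocks whose scaled cell lies wholly in \<open>U\<close> are kept, so that
    their points are lattice points of c U; the rest is accounted for as a loss at the end.\<close>
  define Z where "Z n = {z. grid_cell (h n) z \<subseteq> U}" for n
  define J where "J n = trimmed_block (T n) (g n)" for n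
  define L where "L n = lattice_points (vec_scale (c n) U)" for n
  define P where "P n = (\<Prod>l\<in>UNIV. c n $ l)" for n
  define p where "p n = prob {\<omega> \<in> space M. \<xi> 0 \<omega> > x n}" for n
  define V where "V n = (\<Prod>l\<in>UNIV. real_of_int (T n $ l - g n $ l))" for n
  define A where "A n = A_set ord (c n) (k n) 0" for n
  \<comment> \<open>The quotient \<open>e n / p n\<close> is the conditional probability in the
    local condition: given an exceedance at the origin, no later site within one block side
    exceeds.\<close>
  define e where "e n = prob {\<omega> \<in> space M. \<xi> 0 \<omega> > x n \<and> (\<forall>v\<in>A n. \<xi> v \<omega> \<le> x n)}" for n
  define a where "a n = 1 - prob (void (x n) (J n 0))" for n
  have side: "block_side (c n) (k n) = real_vec (T n)" for n
    by (simp add: block_side_def real_vec_def T_def X_def rt_def vec_eq_iff)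
  have rt_pos: "0 < rt n" for n using k_pos[of n] by (simp add: rt_def)
  have X_pos: "0 < X l n" for l n using c_pos rt_pos by (simp add: X_def)
  have P_pos: "0 < P n" for n using c_pos by (simp add: P_def prod_pos)
  have rk_lim: "filterlim (\<lambda>n. real (k n)) at_top sequentially"
    using filterlim_compose[OF filterlim_real_sequentially k_lim] .
  have rt_lim: "filterlim rt at_top sequentially"
    unfolding rt_def using rk_lim by (intro filterlim_root_at_top) auto
  have rt_pow: "rt n ^ CARD('d) = real (k n)" for n
    by (simp add: rt_def)
  have X_lim: "filterlim (X l) at_top sequentially" for l
  proof -
    have "(\<lambda>n. rt n / c n $ l) \<longlonglongrightarrow> 0"
      using k_small by (simp add: vec_small_o_def rt_def)
    then have "filterlim (\<lambda>n. inverse (rt n / c n $ l)) at_top sequentially"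
      using c_pos rt_pos by (intro filterlim_inverse_at_top) auto
    then show ?thesis by (simp add: X_def[abs_def])
  qed
  have TX: "(\<lambda>n. real_of_int (T n $ l) / X l n) \<longlonglongrightarrow> 1" for l
    using tendsto_floor_ratio[OF X_lim[of l]] by (simp add: T_def)
  have gX: "(\<lambda>n. real_of_int (g n $ l) / X l n) \<longlonglongrightarrow> 0" for l
  proof -
    \<comment> \<open>This is |\<gamma>| / X rewritten in terms of the hypothesis; the additional 1
      / X pays for the ceiling in \<open>g\<close>.\<close>
    have "(\<lambda>n. \<bar>rt n * \<gamma> n $ l / c n $ l\<bar>) \<longlonglongrightarrow> 0"
      using k\<gamma> by (intro tendsto_rabs_zero) (simp add: vec_small_o_def rt_def)
    moreover have "(\<lambda>n. inverse (X l n)) \<longlonglongrightarrow> 0"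
      using tendsto_inverse_0_at_top[OF X_lim] .
    ultimately have upper: "(\<lambda>n. \<bar>rt n * \<gamma> n $ l / c n $ l\<bar> + inverse (X l n)) \<longlonglongrightarrow> 0"
      using tendsto_add_zero by blast
    show ?thesis
    proof (rule tendsto_sandwich[OF _ _ tendsto_const upper])
      show "\<forall>\<^sub>F n in sequentially. 0 \<le> real_of_int (g n $ l) / X l n"
        using X_pos by (intro always_eventually allI divide_nonneg_pos) (simp_all add: g_def)
      show "\<forall>\<^sub>F n in sequentially. real_of_int (g n $ l) / X l n \<le> \<bar>rt n * \<gamma> n $ l / c n $ l\<bar> + inverse (X l n)"
      proof (intro always_eventually allI)
        fix n
        have "real_of_int (g n $ l) / X l n \<le> (\<bar>\<gamma> n $ l\<bar> + 1) / X l n"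
          using X_pos[of l n] by (intro divide_right_mono) (simp_all add: g_def of_int_ceiling_le_add_one)
        also have "\<dots> = \<bar>rt n * \<gamma> n $ l / c n $ l\<bar> + inverse (X l n)"
          using rt_pos[of n] c_pos[of n l] by (simp add: X_def abs_mult field_simps)
        finally show "real_of_int (g n $ l) / X l n \<le> \<bar>rt n * \<gamma> n $ l / c n $ l\<bar> + inverse (X l n)" .
      qed
    qed
  qed
  have TgX: "(\<lambda>n. real_of_int (T n $ l - g n $ l) / X l n) \<longlonglongrightarrow> 1" for l
    using tendsto_diff[OF TX[of l] gX[of l]] by (simp add: diff_divide_distrib)
  have g_nonneg: "0 \<le> g n $ l" and g_ge: "\<bar>\<gamma> n $ l\<bar> \<le> real_of_int (g n $ l)" for n l
    by (simp_all add: g_def)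
  \<comment> \<open>For small n the rounded side may be 0 or may not exceed the gap, so facts about
    actual blocks hold only eventually, under this condition.\<close>
  have good: "\<forall>\<^sub>F n in sequentially. \<forall>l. g n $ l < T n $ l"
  proof (rule eventually_all_finite)
    fix l
    have "\<forall>\<^sub>F n in sequentially. 0 < real_of_int (T n $ l - g n $ l) / X l n"
      using order_tendstoD(1)[OF TgX[of l]] by simp
    then show "\<forall>\<^sub>F n in sequentially. g n $ l < T n $ l"
    proof eventually_elim
      case (elim n)
      then show ?case using X_pos[of l n] by (simp add: zero_less_divide_iff)
    qed
  qed
  have T_pos: "0 < T n $ l" if "\<forall>l. g n $ l < T n $ l" for n l
    using that g_nonneg[of n l] by (metis le_less_trans)
  have h_pos: "0 < h n $ l" if "\<forall>l. g n $ l < T n $ l" for n l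
    using T_pos[OF that] c_pos by (simp add: h_def vec_quot_def real_vec_def)
  \<comment> \<open>The d factors k^(1/d) multiply to k, so a block has about P / k lattice
    points.\<close>
  have X_prod: "(\<Prod>l\<in>UNIV. X l n) = P n / real (k n)" for n
    by (simp add: X_def P_def prod_dividef rt_pow)
  have V_lim: "(\<lambda>n. V n * real (k n) / P n) \<longlonglongrightarrow> 1"
  proof -
    have "(\<lambda>n. \<Prod>l\<in>UNIV. real_of_int (T n $ l - g n $ l) / X l n) \<longlonglongrightarrow> (\<Prod>l\<in>(UNIV::'d set). 1)"
      by (intro tendsto_prod TgX)
    then show ?thesis by (simp add: prod_dividef X_prod V_def del: of_int_diff)
  qed
  have h_prod: "(\<lambda>n. real (k n) * (\<Prod>l\<in>UNIV. h n $ l)) \<longlonglongrightarrow> 1"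
  proof -
    have "(\<lambda>n. \<Prod>l\<in>UNIV. real_of_int (T n $ l) / X l n) \<longlonglongrightarrow> (\<Prod>l\<in>(UNIV::'d set). 1)"
      by (intro tendsto_prod TX)
    moreover have "(\<Prod>l\<in>UNIV. real_of_int (T n $ l) / X l n) = real (k n) * (\<Prod>l\<in>UNIV. h n $ l)" for n
      by (simp add: prod_dividef X_prod h_def vec_quot_def real_vec_def P_def)
    ultimately show ?thesis by simp
  qed
  have pP: "(\<lambda>n. p n * P n) \<longlonglongrightarrow> \<tau>" using \<tau>(2) by (simp add: p_def P_def)
  have Z_count: "(\<lambda>n. real (card (Z n)) * (\<Prod>l\<in>UNIV. h n $ l)) \<longlonglongrightarrow> measure lborel U"
  proof (rule cell_count_tendsto[OF U(2-4)])
    show "\<forall>\<^sub>F n in sequentially. \<forall>l. 0 < h n $ l"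
      using good by eventually_elim (simp add: h_pos)
    show "(\<lambda>n. h n $ l) \<longlonglongrightarrow> 0" for l
    proof -
      have "(\<lambda>n. real_of_int (T n $ l) / X l n * inverse (rt n)) \<longlonglongrightarrow> 1 * 0"
        by (intro tendsto_mult TX tendsto_inverse_0_at_top rt_lim)
      moreover have "real_of_int (T n $ l) / X l n * inverse (rt n) = h n $ l" for n
        using rt_pos[of n] by (simp add: X_def h_def vec_quot_def real_vec_def)
      ultimately show ?thesis by simp
    qed
    show "\<forall>\<^sub>F n in sequentially. \<forall>z\<in>Z n. grid_cell (h n) z \<inter> U \<noteq> {}"
      using good
    proof eventually_elim
      case (elim n)
      show ?case
      proof
        fix z assume "z \<in> Z n"
        moreover have "h n * real_vec z \<in> grid_cell (h n) z"
          using h_pos[OF elim] by (intro real_vec_mem_grid_cell)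
        ultimately show "grid_cell (h n) z \<inter> U \<noteq> {}" unfolding Z_def by blast
      qed
    qed
  qed (simp add: Z_def)
  have Z_k: "(\<lambda>n. real (card (Z n)) / real (k n)) \<longlonglongrightarrow> measure lborel U"
  proof -
    have "(\<lambda>n. real (card (Z n)) * (\<Prod>l\<in>UNIV. h n $ l) / (real (k n) * (\<Prod>l\<in>UNIV. h n $ l)))
        \<longlonglongrightarrow> measure lborel U / 1"
      by (intro tendsto_divide Z_count h_prod) simp
    moreover have "\<forall>\<^sub>F n in sequentially. real (card (Z n)) * (\<Prod>l\<in>UNIV. h n $ l) / (real (k n) * (\<Prod>l\<in>UNIV. h n $ l))
        = real (card (Z n)) / real (k n)"
      using good
    proof eventually_elim
      case (elim n)
      have "(\<Prod>l\<in>UNIV. h n $ l) \<noteq> 0" using h_pos[OF elim] by (simp add: less_imp_neq[THEN not_sym])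
      then show ?case by simp
    qed
    ultimately show ?thesis by (simp add: Lim_transform_eventually)
  qed
  have kVp: "(\<lambda>n. real (k n) * (V n * p n)) \<longlonglongrightarrow> \<tau>"
  proof -
    have "(\<lambda>n. (V n * real (k n) / P n) * (p n * P n)) \<longlonglongrightarrow> 1 * \<tau>"
      by (intro tendsto_mult V_lim pP)
    moreover have "(V n * real (k n) / P n) * (p n * P n) = real (k n) * (V n * p n)" for n
      using P_pos[of n] by simp
    ultimately show ?thesis by simp
  qed
  have kVe: "(\<lambda>n. real (k n) * (V n * e n)) \<longlonglongrightarrow> \<tau>"
  proof -
    have "{\<omega> \<in> space M. field_max \<xi> (A n) \<omega> \<le> ereal (x n) \<and> \<xi> 0 \<omega> > x n} =
        {\<omega> \<in> space M. \<xi> 0 \<omega> > x n \<and> (\<forall>v\<in>A n. \<xi> v \<omega> \<le> x n)}" for n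
      by (auto simp: field_max_def SUP_le_iff)
    then have "(\<lambda>n. e n / p n) \<longlonglongrightarrow> 1"
      using local by (simp add: condition_D_local_def cond_prob_def e_def p_def A_def)
    then have "(\<lambda>n. real (k n) * (V n * p n) * (e n / p n)) \<longlonglongrightarrow> \<tau> * 1"
      by (intro tendsto_mult kVp)
    \<comment> \<open>As \<tau> is positive, \<open>p n\<close> is eventually nonzero and may be
      cancelled.\<close>
    moreover have "\<forall>\<^sub>F n in sequentially. real (k n) * (V n * p n) * (e n / p n) = real (k n) * (V n * e n)"
      using order_tendstoD(1)[OF pP \<tau>(1)] by eventually_elim auto
    ultimately show ?thesis by (simp add: Lim_transform_eventually)
  qed
  have card_J: "real (card (J n z)) = V n" if "\<forall>l. g n $ l < T n $ l" for n z
    unfolding J_def V_def using that by (intro card_trimmed_block) (simp add: less_imp_le)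
  have ka: "(\<lambda>n. real (k n) * a n) \<longlonglongrightarrow> \<tau>"
  proof (rule tendsto_sandwich[OF _ _ kVe kVp])
    show "\<forall>\<^sub>F n in sequentially. real (k n) * (V n * e n) \<le> real (k n) * a n"
      using good
    proof eventually_elim
      case (elim n)
      have "real (card (J n 0)) * e n \<le> a n"
        unfolding e_def a_def
      proof (rule prob_void_last_exceedance[OF ord])
        fix v w assume vw: "v \<in> J n 0" "w \<in> J n 0" "(v, w) \<in> ord" "v \<noteq> w"
        have "(0, w - v) \<in> ord"
          using ord vw(3) unfolding translation_invariant_order_def
          by (metis add.right_inverse diff_conv_add_uminus)
        \<comment> \<open>Two sites of one block differ by less than a block side in each
          coordinate, so the window [-T, T] of the local condition contains their
          difference.\<close>
        moreover have "\<bar>(w - v) $ l\<bar> \<le> T n $ l" for l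
        proof -
          have "0 \<le> v $ l" "v $ l < T n $ l - g n $ l" "0 \<le> w $ l" "w $ l < T n $ l - g n $ l"
            using vw(1,2) by (auto simp: J_def mem_trimmed_block)
          then show ?thesis using g_nonneg[of n l] by simp
        qed
        ultimately show "w - v \<in> A n"
          unfolding A_def using vw(4) T_pos[OF elim] side by (intro mem_A_set_zero) auto
      qed (simp add: J_def)
      then show ?case using card_J[OF elim] by (simp add: mult_left_mono)
    qed
    show "\<forall>\<^sub>F n in sequentially. real (k n) * a n \<le> real (k n) * (V n * p n)"
      using good
    proof eventually_elim
      case (elim n)
      have "prob (void (x n) {}) - prob (void (x n) (J n 0)) \<le> real (card (J n 0 - {})) * p n"
        unfolding p_def by (intro prob_void_diff_le) (auto simp: J_def)
      then show ?case using card_J[OF elim] by (simp add: a_def mult_left_mono)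
    qed
  qed
  have a_nonneg: "0 \<le> a n" for n by (simp add: a_def)
  have a_lim: "a \<longlonglongrightarrow> 0"
  proof -
    have "(\<lambda>n. real (k n) * a n * inverse (real (k n))) \<longlonglongrightarrow> \<tau> * 0"
      by (intro tendsto_mult ka tendsto_inverse_0_at_top rk_lim)
    moreover have "real (k n) * a n * inverse (real (k n)) = a n" for n
      using k_pos[of n] by simp
    ultimately show ?thesis by simp
  qed
  have Za: "(\<lambda>n. real (card (Z n)) * a n) \<longlonglongrightarrow> \<tau> * measure lborel U"
  proof -
    have "(\<lambda>n. real (card (Z n)) / real (k n) * (real (k n) * a n)) \<longlonglongrightarrow> measure lborel U * \<tau>"
      by (intro tendsto_mult Z_k ka)
    moreover have "real (card (Z n)) / real (k n) * (real (k n) * a n) = real (card (Z n)) * a n" for n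
      using k_pos[of n] by simp
    ultimately show ?thesis by (simp add: mult.commute)
  qed
  have Z\<alpha>: "(\<lambda>n. real (card (Z n)) * \<alpha> n) \<longlonglongrightarrow> 0"
  proof -
    have "(\<lambda>n. real (card (Z n)) / real (k n) * (real (k n) * \<alpha> n)) \<longlonglongrightarrow> measure lborel U * 0"
      by (intro tendsto_mult Z_k k\<alpha>)
    moreover have "real (card (Z n)) / real (k n) * (real (k n) * \<alpha> n) = real (card (Z n)) * \<alpha> n" for n
      using k_pos[of n] by simp
    ultimately show ?thesis by simp
  qed
  have Z_fin: "finite (Z n)" if "\<forall>l. g n $ l < T n $ l" for n
  proof (rule finite_subset[OF _ finite_cells_meeting_bounded[OF h_pos[OF that] U(2)]])
    show "Z n \<subseteq> {z. grid_cell (h n) z \<inter> U \<noteq> {}}"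
      using real_vec_mem_grid_cell[OF h_pos[OF that]] unfolding Z_def by blast
  qed
  have J_cell: "vec_quot (real_vec v) (c n) \<in> grid_cell (h n) z" if "v \<in> J n z" for n z v
    using that unfolding J_def h_def by (rule trimmed_block_in_cell[OF _ g_nonneg c_pos])
  have J_L: "J n z \<subseteq> L n" if "z \<in> Z n" for n z
    using J_cell that unfolding Z_def L_def subset_iff mem_lattice_points_vec_scale[OF c_pos] by blast
  have J_K: "J n z \<subseteq> K n" if "\<forall>l. g n $ l < T n $ l" "z \<in> Z n" for n z
  proof
    fix v assume v: "v \<in> J n z"
    then have "real_vec v \<in> block_I (c n) (k n) z"
      unfolding J_def using T_pos[OF that(1)] by (intro trimmed_block_in_block_I[OF _ g_nonneg _ side])
    \<comment> \<open>The block point \<open>v\<close> itself witnesses that its block meets c C,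
      because \<open>U\<close> lies in \<open>C\<close>.\<close>
    moreover have "real_vec v \<in> vec_scale (c n) C"
      using J_L[OF that(2)] v U(1) unfolding L_def lattice_points_def vec_scale_def by blast
    ultimately have "v \<in> D_plus C (c n) (k n)"
      unfolding D_plus_def block_J_def lattice_points_def by blast
    then show "v \<in> K n" using K by blast
  qed
  let ?Q = "\<lambda>n. prob (void (x n) (\<Union>z\<in>Z n. J n z))"
  have Q_lim: "?Q \<longlonglongrightarrow> exp (- (\<tau> * measure lborel U))"
  proof -
    have "(\<lambda>n. ?Q n - (1 - a n) ^ card (Z n)) \<longlonglongrightarrow> 0"
    proof (rule Lim_null_comparison[OF _ Z\<alpha>])
      show "\<forall>\<^sub>F n in sequentially. norm (?Q n - (1 - a n) ^ card (Z n)) \<le> real (card (Z n)) * \<alpha> n"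
        using good
      proof eventually_elim
        case (elim n)
        have "\<bar>?Q n - (1 - a n) ^ card (Z n)\<bar> \<le> real (card (Z n)) * \<alpha> n"
        proof (rule prob_void_blocks[OF Z_fin[OF elim]])
          show "prob (void (x n) (J n z)) = 1 - a n" for z
            unfolding J_def a_def by (subst trimmed_block_translate) (simp add: prob_void_translate)
          fix z Y assume zY: "z \<in> Z n" "Y \<subseteq> Z n - {z}"
          have "separated (\<gamma> n) (J n z) (\<Union>y\<in>Y. J n y)"
            unfolding J_def using zY T_pos[OF elim] g_ge
            by (intro separated_trimmed_blocks) (auto intro: less_imp_le)
          moreover have "J n z \<subseteq> K n" "(\<Union>y\<in>Y. J n y) \<subseteq> K n"
            using J_K[OF elim] zY by blast+
          moreover have "is_box (J n z)" by (simp add: J_def is_box_trimmed_block)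
          ultimately show "\<bar>prob (void (x n) (J n z \<union> (\<Union>y\<in>Y. J n y))) -
              prob (void (x n) (J n z)) * prob (void (x n) (\<Union>y\<in>Y. J n y))\<bar> \<le> \<alpha> n"
            using D unfolding condition_D_def field_max_event by blast
        qed
        then show ?case by simp
      qed
    qed
    from tendsto_add[OF this power_one_minus_tendsto[OF a_nonneg a_lim Za]] show ?thesis by simp
  qed
  have "(\<lambda>n. prob (void (x n) (L n)) - ?Q n) \<longlonglongrightarrow> 0"
  proof (rule Lim_null_comparison)
    \<comment> \<open>Divided by P, the number of all points of c U and the number of those in
      blocks both tend to |U|, while p P tends to \<tau>. Hence the expected number of exceedances
      outside the blocks vanishes.\<close>
    have "(\<lambda>n. (real (card (L n)) / P n - real (card (Z n)) / real (k n) * (V n * real (k n) / P n)) * (p n * P n))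
        \<longlonglongrightarrow> (measure lborel U - measure lborel U * 1) * \<tau>"
      using lattice_count_tendsto[OF U(2-4) c_pos c_lim]
      by (intro tendsto_intros Z_k V_lim pP) (simp add: L_def P_def)
    moreover have "(real (card (L n)) / P n - real (card (Z n)) / real (k n) * (V n * real (k n) / P n)) * (p n * P n)
       = (real (card (L n)) - real (card (Z n)) * V n) * p n" for n
      using P_pos[of n] k_pos[of n] by (simp add: field_simps)
    ultimately show "(\<lambda>n. (real (card (L n)) - real (card (Z n)) * V n) * p n) \<longlonglongrightarrow> 0"
      by (simp only: mult_1_right diff_self mult_zero_left)
    show "\<forall>\<^sub>F n in sequentially. norm (prob (void (x n) (L n)) - ?Q n) \<le> (real (card (L n)) - real (card (Z n)) * V n) * p n"
      using good
    proof eventually_elim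
      case (elim n)
      let ?J = "\<Union>z\<in>Z n. J n z"
      have L_fin: "finite (L n)"
        unfolding L_def using c_pos U(2) by (rule finite_lattice_points_vec_scale)
      have sub: "?J \<subseteq> L n" using J_L by blast
      have "J n z \<inter> J n z' = {}" if "z \<noteq> z'" for z z'
        using J_cell that mem_grid_cell_iff[OF h_pos[OF elim]] by (metis disjoint_iff)
      then have "card ?J = (\<Sum>z\<in>Z n. card (J n z))"
        using Z_fin[OF elim] by (intro card_UN_disjoint) (auto simp: J_def)
      then have "real (card ?J) = real (card (Z n)) * V n"
        by (simp add: card_J[OF elim])
      then have "real (card (L n - ?J)) = real (card (L n)) - real (card (Z n)) * V n"
        using sub L_fin by (simp add: card_Diff_subset finite_subset card_mono)
      then show ?case
        using prob_void_diff_le[OF sub, of "x n"] L_fin prob_void_antimono[OF sub, of "x n"]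
        by (simp add: p_def)
    qed
  qed
  from tendsto_add[OF this Q_lim] show ?thesis by (simp add: L_def)
qed

end

section \<open>Characteristic functions of point processes\<close>

lemma norm_iexp_diff_le: "norm (iexp a - iexp b) \<le> \<bar>a - b\<bar>"
proof -
  have "iexp a - iexp b = iexp b * (iexp (a - b) - 1)"
    by (simp add: algebra_simps exp_diff exp_minus field_simps)
  then have "norm (iexp a - iexp b) = norm (iexp (a - b) - 1)"
    by (simp add: norm_mult)
  also have "\<dots> \<le> \<bar>a - b\<bar>"
    using iexp_approx1[of "a - b" 0] by simp
  finally show ?thesis .
qed

text \<open>For a Poisson count with mean y the left side is the mean minus the probability of a
  nonzero count. Being of second order, it stays small when summed over many small cells.\<close>

lemma exp_minus_le_quadratic:
  fixes y :: real
  assumes "0 \<le> y"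
  shows "y - 1 + exp (- y) \<le> y\<^sup>2"
proof (cases "y \<le> 1")
  case True
  have "exp (- y) * (1 + y) \<le> exp (- y) * exp y"
    using exp_ge_add_one_self[of y] by (intro mult_left_mono) auto
  then have "exp (- y) \<le> 1 / (1 + y)"
    using assms by (simp add: field_simps exp_minus)
  also have "1 / (1 + y) \<le> 1 - y + y\<^sup>2"
    using assms by (simp add: field_simps power2_eq_square)
  finally show ?thesis by simp
next
  case False
  have "y * 1 \<le> y * y" using False by (intro mult_left_mono) auto
  moreover have "exp (- y) \<le> 1" using assms by simp
  ultimately show ?thesis unfolding power2_eq_square by linarith
qed

text \<open>Covers the exceedance processes and the Poisson process alike, so that one estimate of
  characteristic functions serves both. Compactness makes every Borel subset of \<open>C\<close>
  bounded, hence all counts finite.\<close>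

locale compact_point_process = prob_space M
  for M :: "'b measure" +
  fixes C :: "(real ^ 'd) set" and N :: "'b \<Rightarrow> (real ^ 'd) measure"
  assumes compact: "compact C" and point_process: "point_process M C N"
begin

abbreviation "borel_C \<equiv> restrict_space (borel :: (real ^ 'd) measure) C"

lemma C_sets: "C \<in> sets borel_C"
  using sets.top[of borel_C] by (simp add: space_restrict_space)

lemma subset_C: "B \<in> sets borel_C \<Longrightarrow> B \<subseteq> C"
  using sets.sets_into_space[of B borel_C] by (simp add: space_restrict_space)

lemma sets_N: "\<omega> \<in> space M \<Longrightarrow> sets (N \<omega>) = sets borel_C"
  using point_process by (simp add: point_process_def)

lemma space_N: "\<omega> \<in> space M \<Longrightarrow> space (N \<omega>) = C"
  using sets_eq_imp_space_eq[OF sets_N] by (simp add: space_restrict_space)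

lemma emeasure_N_nat:
  assumes "\<omega> \<in> space M" "B \<in> sets borel_C"
  shows "emeasure (N \<omega>) B \<in> \<nat>"
proof -
  have "bounded B"
    using subset_C[OF assms(2)] compact bounded_subset compact_imp_bounded by blast
  then show ?thesis using assms point_process unfolding point_process_def by blast
qed

lemma finite_measure_N:
  assumes "\<omega> \<in> space M"
  shows "finite_measure (N \<omega>)"
proof
  show "emeasure (N \<omega>) (space (N \<omega>)) \<noteq> \<infinity>"
    using emeasure_N_nat[OF assms C_sets] by (auto simp: space_N[OF assms] Nats_def)
qed

lemma measure_N_nat:
  assumes "\<omega> \<in> space M" "B \<in> sets borel_C"
  obtains j :: nat where "measure (N \<omega>) B = real j" "emeasure (N \<omega>) B = of_nat j"
proof -
  obtain j :: nat where "emeasure (N \<omega>) B = of_nat j"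
    using emeasure_N_nat[OF assms] by (auto simp: Nats_def)
  then have "measure (N \<omega>) B = real j"
    by (simp add: measure_def ennreal_of_nat_eq_real_of_nat)
  then show ?thesis using that \<open>emeasure (N \<omega>) B = of_nat j\<close> by blast
qed

lemma measurable_measure_N:
  assumes "B \<in> sets borel_C"
  shows "(\<lambda>\<omega>. measure (N \<omega>) B) \<in> borel_measurable M"
proof -
  have "(\<lambda>\<omega>. emeasure (N \<omega>) B) \<in> borel_measurable M"
    using assms point_process unfolding point_process_def by blast
  then show ?thesis unfolding measure_def by measurable
qed

definition empty_prob :: "(real ^ 'd) set \<Rightarrow> real" where
  "empty_prob B = prob {\<omega> \<in> space M. measure (N \<omega>) B = 0}"

lemma empty_event [measurable]:
  "B \<in> sets borel_C \<Longrightarrow> {\<omega> \<in> space M. measure (N \<omega>) B = 0} \<in> events"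
  using measurable_measure_N by measurable

lemma expectation_occupied:
  assumes "B \<in> sets borel_C"
  shows "expectation (\<lambda>\<omega>. if measure (N \<omega>) B = 0 then 0 else 1) = 1 - empty_prob B"
    and "integrable M (\<lambda>\<omega>. if measure (N \<omega>) B = 0 then 0 else 1 :: real)"
proof -
  let ?E = "space M - {\<omega> \<in> space M. measure (N \<omega>) B = 0}"
  have E: "?E \<in> events" using empty_event[OF assms] by blast
  have eq: "(if measure (N \<omega>) B = 0 then 0 else 1) = (indicator ?E \<omega> :: real)" if "\<omega> \<in> space M" for \<omega>
    using that by (simp add: indicator_def)
  have "expectation (\<lambda>\<omega>. if measure (N \<omega>) B = 0 then 0 else 1 :: real) = expectation (indicator ?E)"
    by (intro Bochner_Integration.integral_cong refl eq)
  also have "\<dots> = 1 - empty_prob B"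
    using E empty_event[OF assms] by (simp add: empty_prob_def prob_compl)
  finally show "expectation (\<lambda>\<omega>. if measure (N \<omega>) B = 0 then 0 else 1) = 1 - empty_prob B" .
  have "integrable M (indicator ?E :: 'b \<Rightarrow> real)"
    using E by (intro integrable_real_indicator) (simp_all add: less_top[symmetric] emeasure_finite)
  then show "integrable M (\<lambda>\<omega>. if measure (N \<omega>) B = 0 then 0 else 1 :: real)"
    by (rule Bochner_Integration.integrable_cong[THEN iffD2, rotated 2]) (simp_all add: eq)
qed

text \<open>Replacing \<open>f\<close> by a constant on each cell costs at most \<delta> per point
  of the process; the bound \<open>F\<close> ensures integrability.\<close>

lemma integral_N_approx:
  fixes f :: "real ^ 'd \<Rightarrow> real"
  assumes I: "finite I" "\<And>i. i \<in> I \<Longrightarrow> U i \<in> sets borel_C" "disjoint_family_on U I" "(\<Union>i\<in>I. U i) = C"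
    and f: "f \<in> borel_measurable borel_C" "\<And>y. y \<in> C \<Longrightarrow> \<bar>f y\<bar> \<le> F"
    and r: "\<And>i y. i \<in> I \<Longrightarrow> y \<in> U i \<Longrightarrow> \<bar>f y - r i\<bar> \<le> \<delta>"
    and \<omega>: "\<omega> \<in> space M"
  shows "\<bar>(\<integral>y. f y \<partial>N \<omega>) - (\<Sum>i\<in>I. r i * measure (N \<omega>) (U i))\<bar> \<le> \<delta> * measure (N \<omega>) C"
proof -
  interpret N: finite_measure "N \<omega>" using finite_measure_N[OF \<omega>] .
  have int_f: "integrable (N \<omega>) f"
  proof (rule N.integrable_const_bound)
    show "AE y in N \<omega>. norm (f y) \<le> F" using f(2) by (auto simp: space_N[OF \<omega>])
    show "f \<in> borel_measurable (N \<omega>)" using f(1) by (simp cong: measurable_cong_sets add: sets_N[OF \<omega>])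
  qed
  have int_i: "integrable (N \<omega>) (\<lambda>y. r i * indicator (U i) y :: real)" if "i \<in> I" for i
    by (intro integrable_mult_right integrable_real_indicator)
      (use I(2)[OF that] in \<open>simp_all add: sets_N[OF \<omega>] less_top[symmetric] N.emeasure_finite\<close>)
  have "(\<integral>y. f y \<partial>N \<omega>) - (\<Sum>i\<in>I. r i * measure (N \<omega>) (U i))
      = (\<integral>y. f y - (\<Sum>i\<in>I. r i * indicator (U i) y) \<partial>N \<omega>)"
  proof -
    have "U i \<inter> space (N \<omega>) = U i" if "i \<in> I" for i
      using subset_C[OF I(2)[OF that]] by (auto simp: space_N[OF \<omega>])
    then show ?thesis
      using int_f int_i by (simp add: Bochner_Integration.integral_diff Bochner_Integration.integral_sum)
  qed
  also have "\<bar>\<dots>\<bar> \<le> (\<integral>y. \<bar>f y - (\<Sum>i\<in>I. r i * indicator (U i) y)\<bar> \<partial>N \<omega>)"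
    by (rule integral_abs_bound)
  also have "\<dots> \<le> (\<integral>y. \<delta> \<partial>N \<omega>)"
  proof (rule integral_mono)
    show "integrable (N \<omega>) (\<lambda>y. \<bar>f y - (\<Sum>i\<in>I. r i * indicator (U i) y)\<bar>)"
      using int_f int_i by auto
    fix y assume "y \<in> space (N \<omega>)"
    then obtain j where j: "j \<in> I" "y \<in> U j" using I(4) by (auto simp: space_N[OF \<omega>])
    have "(\<Sum>i\<in>I. r i * indicator (U i) y) = (\<Sum>i\<in>I. if i = j then r j else 0)"
      using I(3) j by (intro sum.cong) (auto simp: disjoint_family_on_def indicator_def)
    also have "\<dots> = r j" using I(1) j(1) by simp
    finally show "\<bar>f y - (\<Sum>i\<in>I. r i * indicator (U i) y)\<bar> \<le> \<delta>" using r[OF j] by simp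
  qed simp
  also have "\<dots> = \<delta> * measure (N \<omega>) C" by (simp add: space_N[OF \<omega>])
  finally show ?thesis .
qed

text \<open>
  Replacing every count \<open>N(U i)\<close> by its indicator of being positive turns the characteristic
  function into a polynomial in the indicators of \<open>N(U i) = 0\<close>, hence into a linear combination of
  the probabilities that unions of cells are empty.
\<close>

lemma char_approx:
  fixes f :: "real ^ 'd \<Rightarrow> real" and s :: real
  assumes I: "finite I" "\<And>i. i \<in> I \<Longrightarrow> U i \<in> sets borel_C" "disjoint_family_on U I" "(\<Union>i\<in>I. U i) = C"
    and f: "f \<in> borel_measurable borel_C" "\<And>y. y \<in> C \<Longrightarrow> \<bar>f y\<bar> \<le> F"
    and r: "\<And>i y. i \<in> I \<Longrightarrow> y \<in> U i \<Longrightarrow> \<bar>f y - r i\<bar> \<le> \<delta>" "\<And>i. i \<in> I \<Longrightarrow> \<bar>r i\<bar> \<le> F"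
    and meas: "(\<lambda>\<omega>. \<integral>y. f y \<partial>N \<omega>) \<in> borel_measurable M"
    and int: "integrable M (\<lambda>\<omega>. measure (N \<omega>) C)"
  shows "norm ((CLINT \<omega>|M. iexp (s * (\<integral>y. f y \<partial>N \<omega>)))
      - (\<Sum>J\<in>Pow I. (\<Prod>i\<in>J. 1 - iexp (s * r i)) * (\<Prod>i\<in>I - J. iexp (s * r i)) * empty_prob (\<Union>i\<in>J. U i)))
    \<le> \<bar>s\<bar> * (\<delta> * expectation (\<lambda>\<omega>. measure (N \<omega>) C)
        + F * (expectation (\<lambda>\<omega>. measure (N \<omega>) C) - (\<Sum>i\<in>I. 1 - empty_prob (U i))))"
proof -
  define b where "b i \<omega> = (if measure (N \<omega>) (U i) = 0 then 0 else 1 :: real)" for i \<omega>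
  define co where "co J = (\<Prod>i\<in>J. 1 - iexp (s * r i)) * (\<Prod>i\<in>I - J. iexp (s * r i))" for J
  define v where "v J \<omega> = (indicator {\<omega> \<in> space M. measure (N \<omega>) (\<Union>i\<in>J. U i) = 0} \<omega> :: real)" for J \<omega>
  define G where "G \<omega> = iexp (s * (\<Sum>i\<in>I. r i * b i \<omega>))" for \<omega>
  have UJ: "(\<Union>i\<in>J. U i) \<in> sets borel_C" if "J \<subseteq> I" for J
    using I(1,2) that finite_subset by (intro sets.finite_UN) auto
  have additive: "measure (N \<omega>) (\<Union>i\<in>J. U i) = (\<Sum>i\<in>J. measure (N \<omega>) (U i))"
    if "\<omega> \<in> space M" "J \<subseteq> I" for \<omega> J
  proof -
    interpret N: finite_measure "N \<omega>" using finite_measure_N[OF that(1)] .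
    show ?thesis
      using I(1-3) that finite_subset[OF that(2)]
      by (intro N.finite_measure_finite_Union) (auto simp: sets_N disjoint_family_on_def)
  qed
  have G: "G \<omega> = (\<Sum>J\<in>Pow I. co J * v J \<omega>)" if \<omega>: "\<omega> \<in> space M" for \<omega>
  proof -
    have "G \<omega> = (\<Prod>i\<in>I. iexp (s * r i * b i \<omega>))"
      unfolding G_def by (simp add: sum_distrib_left exp_sum[OF I(1)] mult.assoc)
    \<comment> \<open>As \<open>b i\<close> is 0 or 1 and \<open>v {i}\<close> is its complement,
      each factor is affine in \<open>v {i}\<close>. In the expansion of the product,
      \<open>J\<close> collects the cells required to be empty.\<close>
    also have "\<dots> = (\<Prod>i\<in>I. (1 - iexp (s * r i)) * v {i} \<omega> + iexp (s * r i))"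
      using \<omega> by (intro prod.cong) (auto simp: b_def v_def)
    also have "\<dots> = (\<Sum>J\<in>Pow I. (\<Prod>i\<in>J. (1 - iexp (s * r i)) * v {i} \<omega>) * (\<Prod>i\<in>I - J. iexp (s * r i)))"
      using I(1) by (rule prod_add)
    also have "\<dots> = (\<Sum>J\<in>Pow I. co J * v J \<omega>)"
    proof (rule sum.cong)
      fix J assume "J \<in> Pow I"
      then have J: "J \<subseteq> I" "finite J" using I(1) finite_subset by auto
      have "(\<Prod>i\<in>J. v {i} \<omega>) = v J \<omega>"
      proof -
        have "measure (N \<omega>) (\<Union>i\<in>J. U i) = 0 \<longleftrightarrow> (\<forall>i\<in>J. measure (N \<omega>) (U i) = 0)"
          unfolding additive[OF \<omega> J(1)] using J(2) by (simp add: sum_nonneg_eq_0_iff)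
        then show ?thesis
          using \<omega> J(2) by (auto simp: v_def indicator_def prod_zero_iff)
      qed
      then have "(\<Prod>i\<in>J. complex_of_real (v {i} \<omega>)) = v J \<omega>" by (simp flip: of_real_prod)
      then show "(\<Prod>i\<in>J. (1 - iexp (s * r i)) * v {i} \<omega>) * (\<Prod>i\<in>I - J. iexp (s * r i)) = co J * v J \<omega>"
        by (simp add: co_def prod.distrib)
    qed simp
    finally show ?thesis .
  qed
  have v_int: "integrable M (\<lambda>\<omega>. complex_of_real (v J \<omega>))" if "J \<in> Pow I" for J
    unfolding v_def using empty_event[OF UJ[of J]] that
    by (intro integrable_of_real integrable_real_indicator) (simp_all add: less_top[symmetric] emeasure_finite)
  have v_exp: "expectation (v J) = empty_prob (\<Union>i\<in>J. U i)" if "J \<in> Pow I" for J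
    using empty_event[OF UJ[of J]] that by (simp add: v_def[abs_def] empty_prob_def)
  have G_int: "integrable M G"
    by (subst Bochner_Integration.integrable_cong[OF refl G]) (auto intro!: v_int)
  have G_exp: "(CLINT \<omega>|M. G \<omega>) = (\<Sum>J\<in>Pow I. co J * empty_prob (\<Union>i\<in>J. U i))"
    by (subst Bochner_Integration.integral_cong[OF refl G]) (simp_all add: v_int v_exp)
  have f_int: "integrable M (\<lambda>\<omega>. iexp (s * (\<integral>y. f y \<partial>N \<omega>)))"
  proof (rule integrable_iexp)
    show "(\<lambda>\<omega>. complex_of_real (s * (\<integral>y. f y \<partial>N \<omega>))) \<in> borel_measurable M"
    proof (rule measurable_compose[of _ M borel complex_of_real])
      show "(\<lambda>\<omega>. s * (\<integral>y. f y \<partial>N \<omega>)) \<in> borel_measurable M"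
        by (intro borel_measurable_times borel_measurable_const meas)
      show "complex_of_real \<in> borel_measurable borel"
        by (intro borel_measurable_continuous_onI continuous_intros)
    qed
  qed simp
  have cell_int: "integrable M (\<lambda>\<omega>. measure (N \<omega>) (U i))" if "i \<in> I" for i
  proof (rule Bochner_Integration.integrable_bound[OF int])
    show "(\<lambda>\<omega>. measure (N \<omega>) (U i)) \<in> borel_measurable M"
      using measurable_measure_N I(2) that by blast
    show "AE \<omega> in M. norm (measure (N \<omega>) (U i)) \<le> norm (measure (N \<omega>) C)"
    proof (rule AE_I2)
      fix \<omega> assume \<omega>: "\<omega> \<in> space M"
      interpret N: finite_measure "N \<omega>" using finite_measure_N[OF \<omega>] .
      show "norm (measure (N \<omega>) (U i)) \<le> norm (measure (N \<omega>) C)"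
        using subset_C[OF I(2)[OF that]] C_sets by (auto simp: sets_N[OF \<omega>] intro!: N.finite_measure_mono)
    qed
  qed
  have b_int: "integrable M (b i)" and b_exp: "expectation (b i) = 1 - empty_prob (U i)" if "i \<in> I" for i
    using expectation_occupied[OF I(2)[OF that]] by (simp_all add: b_def[abs_def])
  \<comment> \<open>The first summand is the oscillation of \<open>f\<close> within cells, the
    second counts the points beyond the first in each cell, weighted by the bound on
    \<open>r i\<close>.\<close>
  define R where "R \<omega> = \<bar>s\<bar> * (\<delta> * measure (N \<omega>) C + F * (measure (N \<omega>) C - (\<Sum>i\<in>I. b i \<omega>)))" for \<omega>
  have R: "norm (iexp (s * (\<integral>y. f y \<partial>N \<omega>)) - G \<omega>) \<le> R \<omega>" if \<omega>: "\<omega> \<in> space M" for \<omega>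
  proof -
    have C_eq: "measure (N \<omega>) C = (\<Sum>i\<in>I. measure (N \<omega>) (U i))"
      using additive[OF \<omega>, of I] I(4) by simp
    have "\<bar>(\<Sum>i\<in>I. r i * measure (N \<omega>) (U i)) - (\<Sum>i\<in>I. r i * b i \<omega>)\<bar>
        \<le> (\<Sum>i\<in>I. \<bar>r i * (measure (N \<omega>) (U i) - b i \<omega>)\<bar>)"
      unfolding sum_subtractf[symmetric] right_diff_distrib[symmetric] by (rule sum_abs)
    also have "\<dots> \<le> (\<Sum>i\<in>I. F * (measure (N \<omega>) (U i) - b i \<omega>))"
    proof (rule sum_mono)
      fix i assume i: "i \<in> I"
      obtain j :: nat where "measure (N \<omega>) (U i) = real j"
        using measure_N_nat[OF \<omega> I(2)[OF i]] by blast
      then have "0 \<le> measure (N \<omega>) (U i) - b i \<omega>" by (simp add: b_def)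
      then show "\<bar>r i * (measure (N \<omega>) (U i) - b i \<omega>)\<bar> \<le> F * (measure (N \<omega>) (U i) - b i \<omega>)"
        using r(2)[OF i] by (simp add: abs_mult mult_right_mono)
    qed
    also have "\<dots> = F * (measure (N \<omega>) C - (\<Sum>i\<in>I. b i \<omega>))"
      by (simp add: C_eq sum_distrib_left sum_subtractf right_diff_distrib)
    finally have count: "\<bar>(\<Sum>i\<in>I. r i * measure (N \<omega>) (U i)) - (\<Sum>i\<in>I. r i * b i \<omega>)\<bar>
        \<le> F * (measure (N \<omega>) C - (\<Sum>i\<in>I. b i \<omega>))" .
    have "\<bar>(\<integral>y. f y \<partial>N \<omega>) - (\<Sum>i\<in>I. r i * measure (N \<omega>) (U i))\<bar> \<le> \<delta> * measure (N \<omega>) C"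
      by (rule integral_N_approx[OF I f _ \<omega>]) (auto intro: r(1))
    with count have "\<bar>(\<integral>y. f y \<partial>N \<omega>) - (\<Sum>i\<in>I. r i * b i \<omega>)\<bar>
        \<le> \<delta> * measure (N \<omega>) C + F * (measure (N \<omega>) C - (\<Sum>i\<in>I. b i \<omega>))"
      by linarith
    then have "\<bar>s * (\<integral>y. f y \<partial>N \<omega>) - s * (\<Sum>i\<in>I. r i * b i \<omega>)\<bar> \<le> R \<omega>"
      unfolding R_def right_diff_distrib[symmetric] abs_mult by (rule mult_left_mono) simp
    then show ?thesis unfolding G_def using norm_iexp_diff_le order_trans by blast
  qed
  have "(CLINT \<omega>|M. iexp (s * (\<integral>y. f y \<partial>N \<omega>))) - (CLINT \<omega>|M. G \<omega>)
      = (CLINT \<omega>|M. iexp (s * (\<integral>y. f y \<partial>N \<omega>)) - G \<omega>)"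
    using f_int G_int by simp
  also have "norm \<dots> \<le> expectation (\<lambda>\<omega>. norm (iexp (s * (\<integral>y. f y \<partial>N \<omega>)) - G \<omega>))"
    by (rule integral_norm_bound)
  also have "\<dots> \<le> expectation R"
  proof (rule integral_mono)
    show "integrable M R" unfolding R_def using int b_int by auto
    show "integrable M (\<lambda>\<omega>. norm (iexp (s * (\<integral>y. f y \<partial>N \<omega>)) - G \<omega>))"
      using f_int G_int by (intro integrable_norm Bochner_Integration.integrable_diff)
  qed (rule R)
  also have "\<dots> = \<bar>s\<bar> * (\<delta> * expectation (\<lambda>\<omega>. measure (N \<omega>) C)
        + F * (expectation (\<lambda>\<omega>. measure (N \<omega>) C) - (\<Sum>i\<in>I. 1 - empty_prob (U i))))"
    unfolding R_def using int b_int by (simp add: b_exp Bochner_Integration.integral_sum)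
  finally show ?thesis by (simp add: G_exp co_def)
qed

end

section \<open>Partitions of a compact set into small cells\<close>

lemma grid_partition:
  fixes C :: "(real ^ 'd) set" and f :: "real ^ 'd \<Rightarrow> real"
  assumes C: "compact C" and f: "continuous_on C f" and \<delta>: "0 < \<delta>"
  shows "\<exists>(I :: (int ^ 'd) set) U. finite I \<and> disjoint_family_on U I \<and> (\<Union>i\<in>I. U i) = C \<and>
    (\<forall>i\<in>I. U i \<in> sets borel \<and> U i \<noteq> {} \<and> (\<forall>y\<in>U i. \<forall>y'\<in>U i. \<bar>f y - f y'\<bar> \<le> \<delta>) \<and>
      measure lborel (U i) \<le> \<delta> \<and> (negligible (frontier C) \<longrightarrow> negligible (frontier (U i))))"
proof -
  have "uniformly_continuous_on C f" using f C by (rule compact_uniformly_continuous)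
  then obtain e where e: "0 < e" "\<And>y y'. y \<in> C \<Longrightarrow> y' \<in> C \<Longrightarrow> dist y' y < e \<Longrightarrow> dist (f y') (f y) < \<delta>"
    unfolding uniformly_continuous_on_def using \<delta> by metis
  \<comment> \<open>A cell has diameter at most d \<eta>, which must stay below the modulus
    \<open>e\<close>; the factor 2 makes this strict. The bounds by 1 and \<delta> give volume
    \<eta>^d \<le> \<eta> \<le> \<delta>.\<close>
  define \<eta> where "\<eta> = min (min 1 \<delta>) (e / (2 * CARD('d)))"
  have \<eta>: "0 < \<eta>" "\<eta> \<le> 1" "\<eta> \<le> \<delta>" "CARD('d) * \<eta> < e"
  proof -
    show "0 < \<eta>" "\<eta> \<le> 1" "\<eta> \<le> \<delta>" using \<delta> e(1) by (auto simp: \<eta>_def)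
    have "CARD('d) * \<eta> \<le> CARD('d) * (e / (2 * CARD('d)))"
      by (intro mult_left_mono) (auto simp: \<eta>_def)
    also have "\<dots> < e" using e(1) by simp
    finally show "CARD('d) * \<eta> < e" .
  qed
  define h :: "real ^ 'd" where "h = (\<chi> l. \<eta>)"
  have h: "0 < h $ l" for l using \<eta> by (simp add: h_def)
  define U where "U z = grid_cell h z \<inter> C" for z
  define I where "I = {z. grid_cell h z \<inter> C \<noteq> {}}"
  have U_sets: "U z \<in> sets borel" for z
    unfolding U_def using C by (intro sets.Int borel_grid_cell borel_closed compact_imp_closed)
  show ?thesis
  proof (intro exI[of _ I] exI[of _ U] conjI ballI impI)
    show "finite I" unfolding I_def
      using finite_cells_meeting_bounded[OF h compact_imp_bounded[OF C]] .
    show "disjoint_family_on U I"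
      by (auto simp: disjoint_family_on_def U_def mem_grid_cell_iff[OF h])
    show "(\<Union>i\<in>I. U i) = C"
    proof
      show "C \<subseteq> (\<Union>i\<in>I. U i)"
      proof
        fix y assume "y \<in> C"
        then have "y \<in> grid_cell h (cell_index h y) \<inter> C" by (simp add: mem_grid_cell_iff[OF h])
        then show "y \<in> (\<Union>i\<in>I. U i)" unfolding U_def I_def by blast
      qed
    qed (auto simp: U_def)
    show "\<bar>f y - f y'\<bar> \<le> \<delta>" if "y \<in> U i" "y' \<in> U i" for i y y'
    proof -
      have "dist y y' < e"
        using dist_grid_cell_le[of y h i y'] that \<eta>(4) by (simp add: U_def h_def)
      then show ?thesis using e(2)[of y' y] that by (simp add: U_def dist_real_def)
    qed
    show "measure lborel (U i) \<le> \<delta>" for i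
    proof -
      have em: "emeasure lborel (grid_cell h i) = ennreal (\<eta> ^ CARD('d))"
        using emeasure_grid_cell[OF h] by (simp add: h_def)
      have "measure lborel (U i) \<le> measure lborel (grid_cell h i)"
        by (rule measure_mono_fmeasurable) (use em U_sets in \<open>auto simp: U_def fmeasurable_def\<close>)
      also have "\<dots> = \<eta> ^ CARD('d)" using em \<eta>(1) by (simp add: measure_def)
      also have "\<dots> \<le> \<eta> ^ 1" using \<eta> by (intro power_decreasing) (auto simp: Suc_leI)
      finally show ?thesis using \<eta>(3) by simp
    qed
    \<comment> \<open>The condition on \<open>C\<close> is kept as a premise because the partition
      also serves for measurability, where nothing is known about the frontier of
      \<open>C\<close>.\<close>
    show "negligible (frontier (U i))" if "negligible (frontier C)" for i
      using negligible_subset[OF negligible_Un[OF negligible_convex_frontier[OF convex_grid_cell] that]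
          frontier_Int_subset] unfolding U_def .
  qed (use U_sets in \<open>auto simp: U_def I_def\<close>)
qed

text \<open>Serves both for \<open>C\<close> as a union of convex bodies and for the unions of cells
  in the inclusion-exclusion formula.\<close>

lemma negligible_frontier_UN:
  fixes U :: "'i \<Rightarrow> 'a::euclidean_space set"
  assumes "finite I" "\<And>i. i \<in> I \<Longrightarrow> negligible (frontier (U i))"
  shows "negligible (frontier (\<Union>i\<in>I. U i))"
  using assms
proof (induction I rule: finite_induct)
  case (insert i I)
  then have "negligible (frontier (U i) \<union> frontier (\<Union>i\<in>I. U i))" by (intro negligible_Un) auto
  then show ?case using negligible_subset[OF _ frontier_Un_subset] by simp
qed simp

text \<open>A point process provides measurability of counts; the integral is a pointwise limit of
  linear combinations of counts, along partitions on whose cells \<open>f\<close> oscillates by at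
  most 1 / (m + 1).\<close>

lemma (in compact_point_process) measurable_integral_N:
  fixes f :: "real ^ 'd \<Rightarrow> real"
  assumes f: "continuous_on C f"
  shows "(\<lambda>\<omega>. \<integral>y. f y \<partial>N \<omega>) \<in> borel_measurable M"
proof -
  have f_meas: "f \<in> borel_measurable borel_C"
    using f by (rule borel_measurable_continuous_on_restrict)
  have "bounded (f ` C)" using compact_continuous_image[OF f compact] compact_imp_bounded by blast
  then obtain F where F: "\<And>y. y \<in> C \<Longrightarrow> \<bar>f y\<bar> \<le> F" by (auto simp: bounded_iff)
  have "\<exists>g. g \<in> borel_measurable M \<and>
      (\<forall>\<omega>\<in>space M. \<bar>(\<integral>y. f y \<partial>N \<omega>) - g \<omega>\<bar> \<le> inverse (real (Suc m)) * measure (N \<omega>) C)" for m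
  proof -
    obtain I :: "(int ^ 'd) set" and U
      where P: "finite I" "disjoint_family_on U I" "(\<Union>i\<in>I. U i) = C"
        and P': "\<forall>i\<in>I. U i \<in> sets borel \<and> U i \<noteq> {} \<and> (\<forall>y\<in>U i. \<forall>y'\<in>U i. \<bar>f y - f y'\<bar> \<le> inverse (real (Suc m)))"
      using grid_partition[OF compact f, of "inverse (real (Suc m))"] by auto
    have U_sets: "U i \<in> sets borel_C" if "i \<in> I" for i
      using P(3) P' that by (auto simp: sets_restrict_space)
    define y where "y i = (SOME y. y \<in> U i)" for i
    have y: "y i \<in> U i" if "i \<in> I" for i using P' that unfolding y_def by (simp add: some_in_eq)
    have y_osc: "\<bar>f y' - f (y i)\<bar> \<le> inverse (real (Suc m))" if "i \<in> I" "y' \<in> U i" for i y'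
      using P' that(2) y[OF that(1)] that(1) by meson
    let ?g = "\<lambda>\<omega>. \<Sum>i\<in>I. f (y i) * measure (N \<omega>) (U i)"
    have "?g \<in> borel_measurable M"
      by (intro borel_measurable_sum borel_measurable_times borel_measurable_const measurable_measure_N U_sets)
    moreover have "\<bar>(\<integral>y. f y \<partial>N \<omega>) - ?g \<omega>\<bar> \<le> inverse (real (Suc m)) * measure (N \<omega>) C" if "\<omega> \<in> space M" for \<omega>
      by (rule integral_N_approx[OF P(1) U_sets P(2,3) f_meas F _ that]) (auto intro: y_osc simp del: of_nat_Suc)
    ultimately show ?thesis by blast
  qed
  then obtain g where g: "\<And>m. g m \<in> borel_measurable M"
      "\<And>m \<omega>. \<omega> \<in> space M \<Longrightarrow> \<bar>(\<integral>y. f y \<partial>N \<omega>) - g m \<omega>\<bar> \<le> inverse (real (Suc m)) * measure (N \<omega>) C"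
    by metis
  show ?thesis
  proof (rule borel_measurable_LIMSEQ_real[OF _ g(1)])
    fix \<omega> assume \<omega>: "\<omega> \<in> space M"
    have "(\<lambda>m. inverse (real (Suc m)) * measure (N \<omega>) C) \<longlonglongrightarrow> 0 * measure (N \<omega>) C"
      by (intro tendsto_intros LIMSEQ_inverse_real_of_nat)
    then have null: "(\<lambda>m. inverse (real (Suc m)) * measure (N \<omega>) C) \<longlonglongrightarrow> 0"
      by (simp only: mult_zero_left)
    have "\<forall>\<^sub>F m in sequentially. norm (g m \<omega> - (\<integral>y. f y \<partial>N \<omega>)) \<le> inverse (real (Suc m)) * measure (N \<omega>) C"
      using g(2)[OF \<omega>] by (intro always_eventually allI) (metis abs_minus_commute real_norm_def)
    then have "(\<lambda>m. g m \<omega> - (\<integral>y. f y \<partial>N \<omega>)) \<longlonglongrightarrow> 0"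
      using null by (rule Lim_null_comparison)
    then show "(\<lambda>m. g m \<omega>) \<longlonglongrightarrow> (\<integral>y. f y \<partial>N \<omega>)" by (rule LIM_zero_cancel)
  qed
qed

section \<open>Exceedance processes and Poisson limits\<close>

context stationary_random_field
begin

lemma emeasure_exceedance:
  assumes c: "\<And>l. 0 < c $ l" and B: "B \<in> sets (restrict_space borel C)" "bounded B"
  shows "emeasure (exceedance_process C \<xi> c x \<omega>) B = of_nat (card {z \<in> lattice_points (vec_scale c B). \<xi> z \<omega> > x})"
proof -
  have "emeasure (exceedance_process C \<xi> c x \<omega>) B =
      (\<integral>\<^sup>+z. indicator {z \<in> lattice_points (vec_scale c B). \<xi> z \<omega> > x} z \<partial>count_space UNIV)"
    unfolding emeasure_exceedance_process[OF B(1)]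
    by (intro nn_integral_cong) (simp add: indicator_def mem_lattice_points_vec_scale[OF c])
  also have "\<dots> = emeasure (count_space UNIV) {z \<in> lattice_points (vec_scale c B). \<xi> z \<omega> > x}"
    by simp
  also have "\<dots> = of_nat (card {z \<in> lattice_points (vec_scale c B). \<xi> z \<omega> > x})"
    using finite_lattice_points_vec_scale[OF c B(2)] by (intro emeasure_count_space_finite) auto
  finally show ?thesis .
qed

lemma measure_exceedance:
  assumes c: "\<And>l. 0 < c $ l" and B: "B \<in> sets (restrict_space borel C)" "bounded B"
  shows "measure (exceedance_process C \<xi> c x \<omega>) B =
    (\<Sum>z\<in>lattice_points (vec_scale c B). indicator {\<omega>. \<xi> z \<omega> > x} \<omega>)"
proof -
  have fin: "finite (lattice_points (vec_scale c B))" using finite_lattice_points_vec_scale[OF c B(2)] .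
  have "measure (exceedance_process C \<xi> c x \<omega>) B = real (card {z \<in> lattice_points (vec_scale c B). \<xi> z \<omega> > x})"
    unfolding measure_def emeasure_exceedance[OF assms] by (simp add: ennreal_of_nat_eq_real_of_nat)
  also have "\<dots> = (\<Sum>z\<in>lattice_points (vec_scale c B). if \<xi> z \<omega> > x then 1 else 0)"
    using fin by (simp add: sum.If_cases Int_def)
  finally show ?thesis by (simp add: indicator_def of_bool_def)
qed

lemma compact_point_process_exceedance:
  assumes c: "\<And>l. 0 < c $ l" and C: "compact C"
  shows "compact_point_process M C (exceedance_process C \<xi> c x)"
proof
  have bdd: "bounded B" if "B \<in> sets (restrict_space borel C)" for B
    using that C bounded_subset compact_imp_bounded by (auto simp: sets_restrict_space)
  have sets_eq: "sets (exceedance_process C \<xi> c x \<omega>) = sets (restrict_space borel C)" for \<omega>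
    using sets.sigma_sets_eq[of "restrict_space borel C"] sets.space_closed[of "restrict_space borel C"]
    unfolding exceedance_process_def by (simp add: space_restrict_space)
  show "point_process M C (exceedance_process C \<xi> c x)"
    unfolding point_process_def
  proof (intro conjI ballI impI)
    fix B assume B: "B \<in> sets (restrict_space borel C)"
    have fin: "finite (lattice_points (vec_scale c B))"
      using finite_lattice_points_vec_scale[OF c bdd[OF B]] .
    have "emeasure (exceedance_process C \<xi> c x \<omega>) B = ennreal (measure (exceedance_process C \<xi> c x \<omega>) B)" for \<omega>
      unfolding measure_def emeasure_exceedance[OF c B bdd[OF B]] by (simp add: ennreal_of_nat_eq_real_of_nat)
    then have "(\<lambda>\<omega>. emeasure (exceedance_process C \<xi> c x \<omega>) B) =
        (\<lambda>\<omega>. ennreal (\<Sum>z\<in>lattice_points (vec_scale c B). indicator {\<omega>. \<xi> z \<omega> > x} \<omega>))"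
      unfolding measure_exceedance[OF c B bdd[OF B]] by (intro ext)
    then show "(\<lambda>\<omega>. emeasure (exceedance_process C \<xi> c x \<omega>) B) \<in> borel_measurable M"
      by simp
  qed (simp_all add: sets_eq emeasure_exceedance[OF c])
qed (rule C)

lemma expectation_exceedance:
  assumes c: "\<And>l. 0 < c $ l" and B: "B \<in> sets (restrict_space borel C)" "bounded B"
  shows "expectation (\<lambda>\<omega>. measure (exceedance_process C \<xi> c x \<omega>) B) =
      real (card (lattice_points (vec_scale c B))) * prob {\<omega> \<in> space M. \<xi> 0 \<omega> > x}"
    and "integrable M (\<lambda>\<omega>. measure (exceedance_process C \<xi> c x \<omega>) B)"
proof -
  have eq: "(\<lambda>\<omega>. indicator {\<omega>. \<xi> z \<omega> > x} \<omega>) = (indicator {\<omega>. \<xi> z \<omega> > x} :: 'a \<Rightarrow> real)" for z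
    by auto
  have E: "{\<omega>. \<xi> z \<omega> > x} \<inter> space M \<in> events" for z
    using measurable_field[of z] by (simp add: Int_def conj_commute)
  have int: "integrable M (indicator {\<omega>. \<xi> z \<omega> > x} :: 'a \<Rightarrow> real)" for z
    unfolding integrable_indicator_iff using E by (simp add: less_top[symmetric])
  have ex: "expectation (indicator {\<omega>. \<xi> z \<omega> > x}) = prob {\<omega> \<in> space M. \<xi> 0 \<omega> > x}" for z
    using prob_exceed_eq[of x z] by (simp add: Int_def conj_commute)
  show "integrable M (\<lambda>\<omega>. measure (exceedance_process C \<xi> c x \<omega>) B)"
    unfolding measure_exceedance[OF assms] by (intro Bochner_Integration.integrable_sum int)
  show "expectation (\<lambda>\<omega>. measure (exceedance_process C \<xi> c x \<omega>) B) =
      real (card (lattice_points (vec_scale c B))) * prob {\<omega> \<in> space M. \<xi> 0 \<omega> > x}"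
    unfolding measure_exceedance[OF assms] by (subst Bochner_Integration.integral_sum) (simp_all only: int ex sum_constant)
qed

text \<open>Passes from the process on \<open>C\<close> to the random field, where the void limit is
  proved.\<close>

lemma empty_prob_exceedance:
  assumes c: "\<And>l. 0 < c $ l" and C: "compact C" and B: "B \<in> sets (restrict_space borel C)"
  shows "compact_point_process.empty_prob M (exceedance_process C \<xi> c x) B =
    prob (void x (lattice_points (vec_scale c B)))"
proof -
  interpret E: compact_point_process M C "exceedance_process C \<xi> c x"
    using c C by (rule compact_point_process_exceedance)
  have B': "bounded B" using E.subset_C[OF B] C bounded_subset compact_imp_bounded by blast
  have "{\<omega> \<in> space M. measure (exceedance_process C \<xi> c x \<omega>) B = 0} = void x (lattice_points (vec_scale c B))"
    using finite_lattice_points_vec_scale[OF c B']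
    unfolding measure_exceedance[OF c B B'] void_def
    by (auto simp: sum_nonneg_eq_0_iff indicator_def not_less)
  then show ?thesis by (simp add: E.empty_prob_def)
qed

end

section \<open>Mean and void probability of a Poisson count\<close>

lemma poisson_mean_sums:
  fixes m :: real
  shows "(\<lambda>j. real j * (m ^ j / fact j * exp (- m))) sums m"
proof -
  have "(\<lambda>j. m ^ j / fact j) sums exp m"
    using exp_converges[of m] by (simp add: divide_inverse mult.commute)
  \<comment> \<open>Multiplying the j-th exponential term by m exp(-m) gives the mean term with
    index j + 1; the mean term with index 0 vanishes.\<close>
  then have "(\<lambda>j. m ^ j / fact j * (m * exp (- m))) sums (exp m * (m * exp (- m)))"
    by (rule sums_mult2)
  moreover have "exp m * (m * exp (- m)) = m" by (simp add: exp_minus)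
  moreover have "m ^ j / fact j * (m * exp (- m)) = real (Suc j) * (m ^ Suc j / fact (Suc j) * exp (- m))" for j
    by (simp add: field_simps del: of_nat_Suc)
  ultimately have "(\<lambda>j. real (Suc j) * (m ^ Suc j / fact (Suc j) * exp (- m))) sums m"
    by (simp only:)
  then show ?thesis by (subst (asm) sums_Suc_iff) simp
qed

text \<open>As counts are finite integers, the count is the sum over j of j times the indicator of
  the value j, and termwise integration yields the Poisson mean series. Working in
  \<open>ennreal\<close> gives integrability along with the value.\<close>

lemma (in compact_point_process) expectation_poisson:
  assumes B: "B \<in> sets borel_C" and "0 \<le> m"
    and pois: "\<And>j::nat. prob {\<omega> \<in> space M. emeasure (N \<omega>) B = of_nat j} = m ^ j / fact j * exp (- m)"
  shows "integrable M (\<lambda>\<omega>. measure (N \<omega>) B)" and "expectation (\<lambda>\<omega>. measure (N \<omega>) B) = m"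
    and "empty_prob B = exp (- m)"
proof -
  have meas: "(\<lambda>\<omega>. emeasure (N \<omega>) B) \<in> borel_measurable M"
    using B point_process unfolding point_process_def by blast
  have ev: "{\<omega> \<in> space M. emeasure (N \<omega>) B = of_nat j} \<in> events" for j :: nat
    using meas by measurable
  have "(\<integral>\<^sup>+\<omega>. ennreal (measure (N \<omega>) B) \<partial>M) =
      (\<integral>\<^sup>+\<omega>. (\<Sum>j::nat. of_nat j * indicator {\<omega> \<in> space M. emeasure (N \<omega>) B = of_nat j} \<omega>) \<partial>M)"
  proof (rule nn_integral_cong)
    fix \<omega> assume \<omega>: "\<omega> \<in> space M"
    obtain i :: nat where i: "measure (N \<omega>) B = real i" "emeasure (N \<omega>) B = of_nat i"
      using measure_N_nat[OF \<omega> B] .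
    have "(\<Sum>j::nat. of_nat j * indicator {\<omega> \<in> space M. emeasure (N \<omega>) B = of_nat j} \<omega>) =
        (\<Sum>j\<in>{i}. of_nat j * indicator {\<omega> \<in> space M. emeasure (N \<omega>) B = of_nat j} \<omega> :: ennreal)"
      by (rule suminf_finite) (auto simp: i(2))
    then show "ennreal (measure (N \<omega>) B) = (\<Sum>j::nat. of_nat j * indicator {\<omega> \<in> space M. emeasure (N \<omega>) B = of_nat j} \<omega>)"
      using \<omega> by (simp add: i ennreal_of_nat_eq_real_of_nat)
  qed
  also have "\<dots> = (\<Sum>j::nat. \<integral>\<^sup>+\<omega>. of_nat j * indicator {\<omega> \<in> space M. emeasure (N \<omega>) B = of_nat j} \<omega> \<partial>M)"
    using ev by (intro nn_integral_suminf borel_measurable_times_ennreal borel_measurable_const borel_measurable_indicator)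
  also have "\<dots> = (\<Sum>j::nat. ennreal (real j * (m ^ j / fact j * exp (- m))))"
  proof (rule suminf_cong)
    fix j :: nat
    have "(\<integral>\<^sup>+\<omega>. of_nat j * indicator {\<omega> \<in> space M. emeasure (N \<omega>) B = of_nat j} \<omega> \<partial>M) =
        of_nat j * ennreal (m ^ j / fact j * exp (- m))"
      unfolding nn_integral_cmult_indicator[OF ev] emeasure_eq_measure pois ..
    also have "\<dots> = ennreal (real j * (m ^ j / fact j * exp (- m)))"
      unfolding ennreal_of_nat_eq_real_of_nat using assms(2) by (intro ennreal_mult[symmetric]) auto
    finally show "(\<integral>\<^sup>+\<omega>. of_nat j * indicator {\<omega> \<in> space M. emeasure (N \<omega>) B = of_nat j} \<omega> \<partial>M) =
        ennreal (real j * (m ^ j / fact j * exp (- m)))" .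
  qed
  also have "\<dots> = ennreal m"
    using assms(2) by (intro suminf_ennreal_eq poisson_mean_sums) simp
  finally have nn: "(\<integral>\<^sup>+\<omega>. ennreal (measure (N \<omega>) B) \<partial>M) = ennreal m" .
  show "integrable M (\<lambda>\<omega>. measure (N \<omega>) B)"
    using measurable_measure_N[OF B] nn by (intro integrableI_nonneg) auto
  show "expectation (\<lambda>\<omega>. measure (N \<omega>) B) = m"
    using measurable_measure_N[OF B] nn assms(2) by (subst integral_eq_nn_integral) auto
  have "{\<omega> \<in> space M. measure (N \<omega>) B = 0} = {\<omega> \<in> space M. emeasure (N \<omega>) B = of_nat 0}"
  proof (intro Collect_cong conj_cong refl)
    fix \<omega> assume \<omega>: "\<omega> \<in> space M"
    obtain i :: nat where "measure (N \<omega>) B = real i" "emeasure (N \<omega>) B = of_nat i"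
      using measure_N_nat[OF \<omega> B] .
    then show "measure (N \<omega>) B = 0 \<longleftrightarrow> emeasure (N \<omega>) B = of_nat 0" by simp
  qed
  then show "empty_prob B = exp (- m)" using pois[of 0] by (simp add: empty_prob_def)
qed

text \<open>A special case of Kallenberg's criterion.\<close>

lemma vd_converges_poisson:
  fixes C :: "(real ^ 'd) set"
  assumes Nn: "\<And>n. compact_point_process M C (Nn n)"
    and N: "homogeneous_poisson_process M' C \<tau> N"
    and C: "negligible (frontier C)" "measure lborel C = 1" and \<tau>: "0 < \<tau>"
    and int: "\<And>n. integrable M (\<lambda>\<omega>. measure (Nn n \<omega>) C)"
    and mean: "(\<lambda>n. \<integral>\<omega>. measure (Nn n \<omega>) C \<partial>M) \<longlonglongrightarrow> \<tau>"
    and void: "\<And>B. B \<in> sets borel \<Longrightarrow> B \<subseteq> C \<Longrightarrow> negligible (frontier B) \<Longrightarrow>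
      (\<lambda>n. compact_point_process.empty_prob M (Nn n) B) \<longlonglongrightarrow> exp (- (\<tau> * measure lborel B))"
  shows "vd_converges C M Nn M' N"
  unfolding vd_converges_def
proof (intro allI impI, elim conjE)
  fix f :: "real ^ 'd \<Rightarrow> real"
  assume f: "continuous_on C f"
  interpret Nn: compact_point_process M C "Nn n" for n by (rule Nn)
  have compact: "compact C" by (rule Nn.compact)
  interpret N: compact_point_process M' C N
    using N compact
    by (auto simp: homogeneous_poisson_process_def compact_point_process_def compact_point_process_axioms_def)
  have sets_C: "B \<in> sets (restrict_space borel C)" if "B \<in> sets borel" "B \<subseteq> C" for B
    using that by (auto simp: sets_restrict_space)
  have C_borel: "C \<in> sets borel" using compact by (simp add: borel_closed compact_imp_closed)
  have N_pois: "integrable M' (\<lambda>\<omega>. measure (N \<omega>) B)" "N.expectation (\<lambda>\<omega>. measure (N \<omega>) B) = \<tau> * measure lborel B"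
      "N.empty_prob B = exp (- (\<tau> * measure lborel B))"
    if "B \<in> sets borel" "B \<subseteq> C" for B
  proof -
    have "bounded B" using that(2) compact bounded_subset compact_imp_bounded by blast
    then have "N.prob {\<omega> \<in> space M'. emeasure (N \<omega>) B = of_nat j} =
        (\<tau> * measure lborel B) ^ j / fact j * exp (- (\<tau> * measure lborel B))" for j :: nat
      using N sets_C[OF that] unfolding homogeneous_poisson_process_def by blast
    then show "integrable M' (\<lambda>\<omega>. measure (N \<omega>) B)" "N.expectation (\<lambda>\<omega>. measure (N \<omega>) B) = \<tau> * measure lborel B"
      "N.empty_prob B = exp (- (\<tau> * measure lborel B))"
      using N.expectation_poisson[OF sets_C[OF that], of "\<tau> * measure lborel B"] \<tau> by simp_all
  qed
  have f_meas: "f \<in> borel_measurable (restrict_space borel C)"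
    using f by (rule borel_measurable_continuous_on_restrict)
  have "bounded (f ` C)" using compact_continuous_image[OF f compact] compact_imp_bounded by blast
  then obtain F' where F': "\<And>y. y \<in> C \<Longrightarrow> \<bar>f y\<bar> \<le> F'" by (auto simp: bounded_iff)
  \<comment> \<open>The maximum with 0 gives 0 \<le> F without exhibiting a point of
    \<open>C\<close>.\<close>
  define F where "F = max 0 F'"
  have F: "0 \<le> F" "\<And>y. y \<in> C \<Longrightarrow> \<bar>f y\<bar> \<le> F" using F' by (auto simp: F_def max.coboundedI2)
  have measn: "(\<lambda>\<omega>. \<integral>y. f y \<partial>Nn n \<omega>) \<in> borel_measurable M" for n
    by (rule Nn.measurable_integral_N[OF f])
  have meas: "(\<lambda>\<omega>. \<integral>y. f y \<partial>N \<omega>) \<in> borel_measurable M'"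
    by (rule N.measurable_integral_N[OF f])
  let ?\<phi>n = "\<lambda>s n. CLINT \<omega>|M. iexp (s * (\<integral>y. f y \<partial>Nn n \<omega>))"
  let ?\<phi> = "\<lambda>s. CLINT \<omega>|M'. iexp (s * (\<integral>y. f y \<partial>N \<omega>))"
  have conv: "?\<phi>n s \<longlonglongrightarrow> ?\<phi> s" for s
  proof (rule tendstoI)
    fix e :: real assume e: "0 < e"
    \<comment> \<open>Chosen so that 2 R \<le> A \<delta> for the limiting error \<open>R\<close>
      below; the factor 2 appears because the exceedance processes and the limit process each
      contribute one \<open>R\<close>.\<close>
    define A where "A = 2 * \<bar>s\<bar> * (\<tau> + F * \<tau>\<^sup>2)"
    have A: "0 \<le> A" using \<tau> F(1) by (simp add: A_def)
    \<comment> \<open>The added 1 avoids division by zero, since \<open>A\<close> is 0 for s =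
      0.\<close>
    define \<delta> where "\<delta> = e / (2 * (A + 1))"
    have \<delta>: "0 < \<delta>" using e A by (simp add: \<delta>_def)
    have "A * \<delta> \<le> (A + 1) * \<delta>" using \<delta> by (intro mult_right_mono) auto
    also have "(A + 1) * \<delta> = e / 2" using A by (simp add: \<delta>_def divide_simps)
    also have "\<dots> < e" using e by simp
    finally have A\<delta>: "A * \<delta> < e" .
    obtain I :: "(int ^ 'd) set" and U
      where I: "finite I" "disjoint_family_on U I" "(\<Union>i\<in>I. U i) = C"
        and P: "\<forall>i\<in>I. U i \<in> sets borel \<and> U i \<noteq> {} \<and> (\<forall>y\<in>U i. \<forall>y'\<in>U i. \<bar>f y - f y'\<bar> \<le> \<delta>) \<and>
          measure lborel (U i) \<le> \<delta> \<and> (negligible (frontier C) \<longrightarrow> negligible (frontier (U i)))"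
      using grid_partition[OF compact f \<delta>] by blast
    have U_borel: "U i \<in> sets borel" and U_ne: "U i \<noteq> {}" and U_small: "measure lborel (U i) \<le> \<delta>"
      and U_frontier: "negligible (frontier (U i))" if "i \<in> I" for i
      using P C(1) that by blast+
    have U_C: "U i \<subseteq> C" if "i \<in> I" for i using I(3) that by blast
    have U_sets: "U i \<in> sets (restrict_space borel C)" if "i \<in> I" for i
      using sets_C[OF U_borel U_C] that by blast
    define r where "r i = f (SOME y. y \<in> U i)" for i
    have some: "(SOME y. y \<in> U i) \<in> U i" if "i \<in> I" for i using U_ne[OF that] by (simp add: some_in_eq)
    have r1: "\<bar>f y - r i\<bar> \<le> \<delta>" if "i \<in> I" "y \<in> U i" for i y
      using P that some[OF that(1)] by (simp add: r_def)
    have r2: "\<bar>r i\<bar> \<le> F" if "i \<in> I" for i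
      unfolding r_def using F(2) U_C[OF that] some[OF that] by blast
    define co where "co J = (\<Prod>i\<in>J. 1 - iexp (s * r i)) * (\<Prod>i\<in>I - J. iexp (s * r i))" for J
    define En where "En n = Nn.expectation (\<lambda>\<omega>. measure (Nn n \<omega>) C)" for n
    define Rn where "Rn n = \<bar>s\<bar> * (\<delta> * En n + F * (En n - (\<Sum>i\<in>I. 1 - Nn.empty_prob n (U i))))" for n
    \<comment> \<open>This is the limit of \<open>Rn\<close> and at the same time the error bound
      for the Poisson process, whose mean and void probabilities are the limits of those of
      \<open>Nn\<close>.\<close>
    define R where "R = \<bar>s\<bar> * (\<delta> * \<tau> + F * (\<tau> - (\<Sum>i\<in>I. 1 - exp (- (\<tau> * measure lborel (U i))))))"
    let ?Sn = "\<lambda>n. \<Sum>J\<in>Pow I. co J * Nn.empty_prob n (\<Union>i\<in>J. U i)"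
    let ?S = "\<Sum>J\<in>Pow I. co J * exp (- (\<tau> * measure lborel (\<Union>i\<in>J. U i)))"
    have boundn: "norm (?\<phi>n s n - ?Sn n) \<le> Rn n" for n
      unfolding co_def Rn_def En_def
      by (rule Nn.char_approx[OF I(1) U_sets I(2,3) f_meas F(2) r1 r2 measn int])
    have UJ: "(\<Union>i\<in>J. U i) \<in> sets borel" "(\<Union>i\<in>J. U i) \<subseteq> C" "negligible (frontier (\<Union>i\<in>J. U i))"
      if "J \<in> Pow I" for J
    proof -
      have J: "finite J" using that I(1) finite_subset by blast
      show "(\<Union>i\<in>J. U i) \<in> sets borel" using J that U_borel by (intro sets.finite_UN) auto
      show "(\<Union>i\<in>J. U i) \<subseteq> C" using that I(3) by blast
      show "negligible (frontier (\<Union>i\<in>J. U i))"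
        using J that U_frontier by (intro negligible_frontier_UN) auto
    qed
    have bound: "norm (?\<phi> s - ?S) \<le> R"
    proof -
      have "norm (?\<phi> s - (\<Sum>J\<in>Pow I. co J * N.empty_prob (\<Union>i\<in>J. U i))) \<le>
          \<bar>s\<bar> * (\<delta> * N.expectation (\<lambda>\<omega>. measure (N \<omega>) C)
            + F * (N.expectation (\<lambda>\<omega>. measure (N \<omega>) C) - (\<Sum>i\<in>I. 1 - N.empty_prob (U i))))"
        unfolding co_def
        by (rule N.char_approx[OF I(1) U_sets I(2,3) f_meas F(2) r1 r2 meas N_pois(1)[OF C_borel order_refl]])
      also have "(\<Sum>J\<in>Pow I. co J * N.empty_prob (\<Union>i\<in>J. U i)) = ?S"
        by (intro sum.cong refl) (simp add: N_pois(3)[OF UJ(1,2)])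
      also have "(\<Sum>i\<in>I. 1 - N.empty_prob (U i)) = (\<Sum>i\<in>I. 1 - exp (- (\<tau> * measure lborel (U i))))"
        by (intro sum.cong refl) (simp add: N_pois(3)[OF U_borel U_C])
      finally show ?thesis
        by (simp add: R_def N_pois(2)[OF C_borel order_refl] C(2))
    qed
    have Sn: "?Sn \<longlonglongrightarrow> ?S"
      by (intro tendsto_intros void UJ)
    have Rn: "Rn \<longlonglongrightarrow> R"
      unfolding Rn_def R_def using mean
      by (intro tendsto_intros void) (auto simp: En_def U_borel U_C U_frontier dest: subsetD[OF U_C])
    have R_le: "2 * R \<le> A * \<delta>"
    proof -
      have fin: "emeasure lborel (U i) \<noteq> \<infinity>" if "i \<in> I" for i
        using U_C[OF that] compact bounded_subset compact_imp_bounded emeasure_bounded_finite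
        by (metis infinity_ennreal_def less_irrefl)
      have total: "(\<Sum>i\<in>I. measure lborel (U i)) = 1"
        using measure_finite_Union[OF I(1) _ I(2), of lborel] U_borel I(3) fin C(2) by (auto simp: image_subset_iff)
      \<comment> \<open>The cell volumes add up to |C| = 1, so \<tau> can be distributed over the
        cells. Each resulting term is at most the square of \<tau> times the volume; one factor of
        the square is bounded through \<delta>, the other sums to 1.\<close>
      have "\<tau> - (\<Sum>i\<in>I. 1 - exp (- (\<tau> * measure lborel (U i))))
          = (\<Sum>i\<in>I. \<tau> * measure lborel (U i) - 1 + exp (- (\<tau> * measure lborel (U i))))"
        using total by (simp add: sum.distrib sum_subtractf sum_distrib_left[symmetric])
      also have "\<dots> \<le> (\<Sum>i\<in>I. \<tau>\<^sup>2 * \<delta> * measure lborel (U i))"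
      proof (rule sum_mono)
        fix i assume i: "i \<in> I"
        have "\<tau> * measure lborel (U i) - 1 + exp (- (\<tau> * measure lborel (U i))) \<le> (\<tau> * measure lborel (U i))\<^sup>2"
          using \<tau> by (intro exp_minus_le_quadratic) simp
        also have "\<dots> = \<tau>\<^sup>2 * (measure lborel (U i) * measure lborel (U i))"
          by (simp add: power2_eq_square)
        also have "\<dots> \<le> \<tau>\<^sup>2 * (\<delta> * measure lborel (U i))"
          using U_small[OF i] by (intro mult_left_mono mult_right_mono) auto
        finally show "\<tau> * measure lborel (U i) - 1 + exp (- (\<tau> * measure lborel (U i))) \<le> \<tau>\<^sup>2 * \<delta> * measure lborel (U i)"
          by (simp add: mult.assoc)
      qed
      also have "\<dots> = \<tau>\<^sup>2 * \<delta>" using total by (simp add: sum_distrib_left[symmetric])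
      finally have "R \<le> \<bar>s\<bar> * (\<delta> * \<tau> + F * (\<tau>\<^sup>2 * \<delta>))"
        unfolding R_def using F(1) by (intro mult_left_mono add_left_mono) auto
      then show ?thesis by (simp add: A_def algebra_simps)
    qed
    have "(\<lambda>n. Rn n + norm (?Sn n - ?S) + R) \<longlonglongrightarrow> R + norm (?S - ?S) + R"
      by (intro tendsto_intros Rn Sn)
    moreover have "R + norm (?S - ?S) + R < e" using R_le A\<delta> by simp
    ultimately have "\<forall>\<^sub>F n in sequentially. Rn n + norm (?Sn n - ?S) + R < e"
      by (rule order_tendstoD(2))
    then show "\<forall>\<^sub>F n in sequentially. dist (?\<phi>n s n) (?\<phi> s) < e"
    proof eventually_elim
      case (elim n)
      have "dist (?\<phi>n s n) (?\<phi> s) \<le> norm (?\<phi>n s n - ?Sn n) + norm (?Sn n - ?S) + norm (?\<phi> s - ?S)"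
        unfolding dist_norm by norm
      then show ?case using boundn[of n] bound elim by linarith
    qed
  qed
  show "weak_conv_m (\<lambda>n. distr M borel (\<lambda>\<omega>. \<integral>y. f y \<partial>Nn n \<omega>)) (distr M' borel (\<lambda>\<omega>. \<integral>y. f y \<partial>N \<omega>))"
  proof (rule levy_continuity)
    fix s
    have iexp_meas: "(\<lambda>y. iexp (s * y)) \<in> borel_measurable borel" by measurable
    show "(\<lambda>n. char (distr M borel (\<lambda>\<omega>. \<integral>y. f y \<partial>Nn n \<omega>)) s) \<longlonglongrightarrow> char (distr M' borel (\<lambda>\<omega>. \<integral>y. f y \<partial>N \<omega>)) s"
      unfolding char_def integral_distr[OF measn iexp_meas] integral_distr[OF meas iexp_meas] by (rule conv)
  qed (use measn meas in auto)
qed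

theorem theorem7p1:
  fixes C :: "(real ^ 'd) set" and p :: nat
    and c :: "nat \<Rightarrow> real ^ 'd"
    and M :: "'a measure" and \<xi> :: "int ^ 'd \<Rightarrow> 'a \<Rightarrow> real"
    and x :: "nat \<Rightarrow> real" and k :: "nat \<Rightarrow> nat" and \<kappa> :: real
    and \<gamma> :: "nat \<Rightarrow> real ^ 'd" and \<alpha> :: "nat \<Rightarrow> real"
    and ord :: "((int ^ 'd) \<times> (int ^ 'd)) set"
    and \<tau> :: real
    and M' :: "'b measure" and N :: "'b \<Rightarrow> (real ^ 'd) measure"
  assumes "p_convex p C" and "measure lborel C = 1"
    and "\<And>n l. 0 < c n $ l" and "\<And>l. filterlim (\<lambda>n. c n $ l) at_top sequentially"
    and "prob_space M" and "stationary_field M \<xi>"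
    and "translation_invariant_order ord"
    and "\<And>n. 0 < k n" and "filterlim k at_top sequentially"
    and "vec_small_o (\<lambda>n. \<chi> l. root CARD('d) (real (k n))) c"
    and "0 < \<kappa>" and "\<And>n. D_plus C (c n) (k n) \<subseteq> K_set \<kappa> (c n)"
    and "condition_D M \<xi> c x (\<lambda>n. K_set \<kappa> (c n)) \<gamma> \<alpha>"
    and "(\<lambda>n. real (k n) * \<alpha> n) \<longlonglongrightarrow> 0"
    and "vec_small_o (\<lambda>n. root CARD('d) (real (k n)) *\<^sub>R \<gamma> n) c"
    and "condition_D_local M \<xi> ord c x k"
    and "0 < \<tau>"
    and "(\<lambda>n. real (card (lattice_points (vec_scale (c n) C))) * \<P>(\<omega> in M. \<xi> 0 \<omega> > x n)) \<longlonglongrightarrow> \<tau>"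
    and "homogeneous_poisson_process M' C \<tau> N"
  shows "vd_converges C M (\<lambda>n. exceedance_process C \<xi> (c n) (x n)) M' N"
proof -
  interpret stationary_random_field M \<xi>
    using assms(5,6) by (simp add: stationary_random_field_def stationary_random_field_axioms_def)
  obtain B where B: "\<And>i. i < p \<Longrightarrow> convex_body (B i)" "C = (\<Union>i<p. B i)"
    using assms(1) unfolding p_convex_def by blast
  have C: "compact C" "negligible (frontier C)"
  proof -
    show "compact C"
      unfolding B(2) using B(1) by (intro compact_UN) (auto simp: convex_body_def)
    show "negligible (frontier C)"
      unfolding B(2) using B(1)
      by (intro negligible_frontier_UN negligible_convex_frontier) (auto simp: convex_body_def)
  qed
  have C_borel: "C \<in> sets borel" using C(1) by (simp add: borel_closed compact_imp_closed)
  have C_sets: "C \<in> sets (restrict_space borel C)" using C_borel by (auto simp: sets_restrict_space)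
  have C_bdd: "bounded C" using C(1) by (rule compact_imp_bounded)
  let ?L = "\<lambda>n. real (card (lattice_points (vec_scale (c n) C)))"
  let ?P = "\<lambda>n. \<Prod>l\<in>UNIV. c n $ l"
  let ?p = "\<lambda>n. prob {\<omega> \<in> space M. \<xi> 0 \<omega> > x n}"
  \<comment> \<open>Since |C| = 1, the number of lattice points of c C is asymptotic to the product
    of the c, which may replace it in the intensity assumption. The void limit for general
    \<open>U\<close> is normalized by this product.\<close>
  have p_lim: "(\<lambda>n. ?p n * ?P n) \<longlonglongrightarrow> \<tau>"
  proof -
    have L: "(\<lambda>n. ?L n / ?P n) \<longlonglongrightarrow> 1"
      using lattice_count_tendsto[OF C_bdd C_borel C(2) assms(3,4)] assms(2) by simp
    have "(\<lambda>n. ?L n * ?p n / (?L n / ?P n)) \<longlonglongrightarrow> \<tau> / 1"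
      by (intro tendsto_divide assms(18) L) simp
    moreover have "\<forall>\<^sub>F n in sequentially. ?L n * ?p n / (?L n / ?P n) = ?p n * ?P n"
      using order_tendstoD(1)[OF L zero_less_one] by eventually_elim auto
    ultimately show ?thesis by (simp add: Lim_transform_eventually)
  qed
  show ?thesis
  proof (rule vd_converges_poisson[OF _ assms(19) C(2) assms(2) assms(17)])
    show "compact_point_process M C (exceedance_process C \<xi> (c n) (x n))" for n
      using assms(3) C(1) by (rule compact_point_process_exceedance)
    show "integrable M (\<lambda>\<omega>. measure (exceedance_process C \<xi> (c n) (x n) \<omega>) C)" for n
      using assms(3) C_sets C_bdd by (rule expectation_exceedance(2))
    show "(\<lambda>n. \<integral>\<omega>. measure (exceedance_process C \<xi> (c n) (x n) \<omega>) C \<partial>M) \<longlonglongrightarrow> \<tau>"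
      using assms(18) by (simp add: expectation_exceedance(1)[OF assms(3) C_sets C_bdd])
    fix U assume U: "U \<in> sets borel" "U \<subseteq> C" "negligible (frontier U)"
    have "U \<in> sets (restrict_space borel C)" using U by (auto simp: sets_restrict_space)
    moreover have "(\<lambda>n. prob (void (x n) (lattice_points (vec_scale (c n) U)))) \<longlonglongrightarrow> exp (- (\<tau> * measure lborel U))"
      using assms(12) U bounded_subset[OF C_bdd U(2)]
      by (intro prob_void_tendsto[OF assms(3,4,7-10) _ assms(13-17) p_lim])
    ultimately show "(\<lambda>n. compact_point_process.empty_prob M (exceedance_process C \<xi> (c n) (x n)) U)
        \<longlonglongrightarrow> exp (- (\<tau> * measure lborel U))"
      by (simp add: empty_prob_exceedance[OF assms(3) C(1)])
  qed
qed

end
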